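(* Let $A$ be a set and $F_q(A)$ the free quandle on $A$. The groups $\mathrm{Inn}^\circ(F_q(A))$, $\mathrm{Pth}^\circ(F_q(A))$ and $F_g^\circ(A)$, and their actions on $F_q(A)$, may be identified: the homomorphism $F_g(A)\to\mathrm{Pth}(F_q(A))$, $a\mapsto\underline{(a,e)}$, restricts to an isomorphism $F_g^\circ(A)\cong\mathrm{Pth}^\circ(F_q(A))$, the canonical homomorphism $s\colon\mathrm{Pth}(F_q(A))\to\mathrm{Inn}(F_q(A))$ restricts to an isomorphism $\mathrm{Pth}^\circ(F_q(A))\cong\mathrm{Inn}^\circ(F_q(A))$, and these isomorphisms are compatible with the actions on $F_q(A)$. Moreover, this group acts freely on $F_q(A)$.
   Context: A rack is a set $X$ with two binary operations $\triangleleft,\triangleleft^{-1}$ such that $(x\triangleleft y)\triangleleft^{-1}y = x = (x\triangleleft^{-1}y)\triangleleft y$ and $(x\triangleleft y)\triangleleft z=(x\triangleleft z)\triangleleft(y\triangleleft z)$; a quandle is a rack with $x\triangleleft x=x$. (The operation $\triangleleft^{-1}$ is determined by $\triangleleft$.) $F_g(A)$ is the free group on $A$ and $F_g^\circ(A)$ is the kernel of the homomorphism $F_g(A)\to\mathbb Z$ sending every $a\in A$ to $1$. The free quandle on $A$ is $F_q(A)=A\times F_g^\circ(A)$ with $(a,g)\triangleleft(b,h)=(a,a^{-1}gh^{-1}bh)$, where $a,b$ in the second component denote the corresponding generators of $F_g(A)$; the unit is $a\mapsto(a,e)$. $F_g^\circ(A)$ acts on $F_q(A)$ on the right by $(a,g)\cdot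 h=(a,gh)$. For a rack $X$, $\mathrm{Pth}(X)$ is the group with generators $\underline x$ ($x\in X$) and relations $\underline{x\triangleleft a}=\underline a^{-1}\underline x\,\underline a$; it acts on the right on $X$ by $x\cdot\underline y=x\triangleleft y$; $\mathrm{Pth}^\circ(X)$ is the kernel of the homomorphism $\mathrm{Pth}(X)\to\mathbb Z$ sending every $\underline x$ to $1$ (equivalently, the subgroup generated by the elements $\underline a\,\underline b^{-1}$). $\mathrm{Inn}(X)$ is the subgroup of $\mathrm{Aut}(X)$ generated by the maps $\mathrm S_y\colon x\mapsto x\triangleleft y$, with composition written so that it acts on the right: $z\cdot(\mathrm S_x\circ\mathrm S_y)=\mathrm S_y(\mathrm S_x(z))$. $s\colon\mathrm{Pth}(X)\to\mathrm{Inn}(X)$ sends $\underline y$ to $\mathrm S_y$, and $\mathrm{Inn}^\circ(X)$ (the transvection group) is the subgroup of $\mathrm{Inn}(X)$ generated by the elements $\mathrm S_a\mathrm S_b^{-1}$ ($a,b\in X$). *)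

theory Defs
  imports "HOL-Algebra.Elementary_Groups" "HOL-Algebra.Bij"
begin

section \<open>Free groups\<close>

text \<open>A letter \<open>(a, True)\<close> stands for the generator \<open>a\<close> and \<open>(a, False)\<close> for its inverse. The
  elements of the free group on \<open>A\<close> are the reduced words in such letters.\<close>

type_synonym 'a letter = "'a \<times> bool"

definition letter_inv :: "'a letter \<Rightarrow> 'a letter"
  where "letter_inv l = (fst l, \<not> snd l)"

definition reduced :: "'a letter list \<Rightarrow> bool"
  where "reduced = successively (\<lambda>l m. m \<noteq> letter_inv l)"

definition push :: "'a letter \<Rightarrow> 'a letter list \<Rightarrow> 'a letter list"
  where "push l w =
    (case w of [] \<Rightarrow> [l] | m # v \<Rightarrow> if m = letter_inv l then v else l # w)"

definition free_group :: "'a set \<Rightarrow> 'a letter list monoid"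
  where "free_group A =
    \<lparr>carrier = {w. reduced w \<and> fst ` set w \<subseteq> A}, monoid.mult = (\<lambda>u v. foldr push u v), one = []\<rparr>"

definition fg_gen :: "'a \<Rightarrow> 'a letter list"
  where "fg_gen a = [(a, True)]"

text \<open>\<open>free_lift G f\<close> is the homomorphism from the free group to \<open>G\<close> that extends \<open>f\<close>.\<close>

definition letter_val :: "('g, 'm) monoid_scheme \<Rightarrow> ('a \<Rightarrow> 'g) \<Rightarrow> 'a letter \<Rightarrow> 'g"
  where "letter_val G f l = (if snd l then f (fst l) else inv\<^bsub>G\<^esub> f (fst l))"

definition free_lift :: "('g, 'm) monoid_scheme \<Rightarrow> ('a \<Rightarrow> 'g) \<Rightarrow> 'a letter list \<Rightarrow> 'g"
  where "free_lift G f w = foldr (\<lambda>l g. letter_val G f l \<otimes>\<^bsub>G\<^esub> g) w \<one>\<^bsub>G\<^esub>"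

text \<open>The group \<open>F\<^sub>g\<^sup>\<circ>(A)\<close>.\<close>

definition free_group0 :: "'a set \<Rightarrow> 'a letter list monoid"
  where "free_group0 A = (free_group A)
    \<lparr>carrier := kernel (free_group A) integer_group (free_lift integer_group (\<lambda>_. 1))\<rparr>"

lemma letter_inv_invol [simp]: "letter_inv (letter_inv l) = l"
  by (simp add: letter_inv_def)

lemma letter_inv_neq [simp]: "letter_inv l \<noteq> l"
  by (simp add: letter_inv_def prod_eq_iff)

lemma reduced_Nil [simp]: "reduced []"
  by (simp add: reduced_def)

lemma reduced_ConsD: "reduced (l # w) \<Longrightarrow> reduced w"
  by (cases w) (auto simp: reduced_def)

lemma reduced_push: "reduced w \<Longrightarrow> reduced (push l w)"
  by (cases w) (auto simp: push_def reduced_def successively_Cons)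

lemma reduced_foldr_push: "reduced v \<Longrightarrow> reduced (foldr push u v)"
  by (induction u) (auto simp: reduced_push)

lemma push_push_inv: "reduced w \<Longrightarrow> push l (push (letter_inv l) w) = w"
  by (cases w) (auto simp: push_def reduced_def successively_Cons split: list.splits)

lemma push_reduced: "reduced (l # w) \<Longrightarrow> push l w = l # w"
  by (cases w) (auto simp: push_def reduced_def)

lemma foldr_push_Nil: "reduced w \<Longrightarrow> foldr push w [] = w"
proof (induction w)
  case (Cons l w)
  then show ?case using reduced_ConsD[of l w] by (simp add: push_reduced)
qed simp

lemma foldr_push_push: "reduced w \<Longrightarrow> foldr push (push l u) w = push l (foldr push u w)"
  by (cases u) (auto simp: push_def[of l "_ # _"] push_def[of l "[]"] push_push_inv reduced_foldr_push)

lemma foldr_push_assoc: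
  "reduced w \<Longrightarrow> foldr push (foldr push u v) w = foldr push u (foldr push v w)"
  by (induction u) (auto simp: foldr_push_push)

lemma set_push: "set (push l w) \<subseteq> insert l (set w)"
  by (cases w) (auto simp: push_def)

lemma set_foldr_push: "set (foldr push u v) \<subseteq> set u \<union> set v"
proof (induction u)
  case (Cons l u)
  then show ?case using set_push[of l "foldr push u v"] by auto
qed simp

lemma foldr_push_inverse:
  assumes "reduced w"
  shows "foldr push (foldr push (rev (map letter_inv u)) []) (foldr push u w) = w"
proof -
  have "foldr push (rev (map letter_inv u)) (foldr push u w) = w"
    using assms
  proof (induction u)
    case (Cons l u)
    have "push (letter_inv l) (push l (foldr push u w)) = foldr push u w"
      using push_push_inv[of "foldr push u w" "letter_inv l"] Cons.prems
      by (simp add: reduced_foldr_push)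
    with Cons show ?case by simp
  qed simp
  then show ?thesis
    using assms by (simp add: foldr_push_assoc reduced_foldr_push)
qed

lemma group_free_group: "group (free_group A)"
proof (rule groupI)
  fix u v assume "u \<in> carrier (free_group A)" "v \<in> carrier (free_group A)"
  then show "u \<otimes>\<^bsub>free_group A\<^esub> v \<in> carrier (free_group A)"
    using set_foldr_push[of u v] by (force simp: free_group_def reduced_foldr_push)
next
  fix u assume u: "u \<in> carrier (free_group A)"
  let ?v = "foldr push (rev (map letter_inv u)) []"
  have "set ?v \<subseteq> letter_inv ` set u"
    using set_foldr_push[of "rev (map letter_inv u)" "[]"] by auto
  then have "fst ` set ?v \<subseteq> A"
    using u by (force simp: free_group_def letter_inv_def)
  moreover have "foldr push ?v u = []"
    using foldr_push_inverse[of "[]" u] u by (simp add: free_group_def foldr_push_Nil)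
  ultimately show "\<exists>v\<in>carrier (free_group A). v \<otimes>\<^bsub>free_group A\<^esub> u = \<one>\<^bsub>free_group A\<^esub>"
    by (intro bexI[of _ ?v]) (auto simp: free_group_def reduced_foldr_push)
qed (auto simp: free_group_def foldr_push_assoc)

lemma fg_gen_in_free_group: "a \<in> A \<Longrightarrow> fg_gen a \<in> carrier (free_group A)"
  by (simp add: fg_gen_def free_group_def reduced_def)

lemma (in group) letter_val_closed:
  "f \<in> A \<rightarrow> carrier G \<Longrightarrow> fst l \<in> A \<Longrightarrow> letter_val G f l \<in> carrier G"
  by (auto simp: letter_val_def)

lemma free_lift_Cons: "free_lift G f (l # w) = letter_val G f l \<otimes>\<^bsub>G\<^esub> free_lift G f w"
  by (simp add: free_lift_def)

lemma (in group) free_lift_closed: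
  "f \<in> A \<rightarrow> carrier G \<Longrightarrow> fst ` set w \<subseteq> A \<Longrightarrow> free_lift G f w \<in> carrier G"
  by (induction w) (auto simp: free_lift_def letter_val_closed)

lemma (in group) free_lift_push:
  assumes f: "f \<in> A \<rightarrow> carrier G" and l: "fst l \<in> A" and w: "fst ` set w \<subseteq> A"
  shows "free_lift G f (push l w) = letter_val G f l \<otimes> free_lift G f w"
proof (cases "\<exists>v. w = letter_inv l # v")
  case True
  then obtain v where v: "w = letter_inv l # v" by blast
  have "f (fst l) \<in> carrier G" using f l by auto
  then have "letter_val G f l \<otimes> letter_val G f (letter_inv l) = \<one>"
    by (simp add: letter_val_def letter_inv_def)
  moreover have "free_lift G f v \<in> carrier G" "letter_val G f l \<in> carrier G"
      "letter_val G f (letter_inv l) \<in> carrier G"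
    using w free_lift_closed[OF f, of v] letter_val_closed[OF f] l
    by (auto simp: v letter_inv_def)
  ultimately have "letter_val G f l \<otimes> (letter_val G f (letter_inv l) \<otimes> free_lift G f v) = free_lift G f v"
    by (simp flip: m_assoc)
  then show ?thesis by (simp add: v push_def free_lift_def)
next
  case False
  then have "push l w = l # w" by (cases w) (auto simp: push_def)
  then show ?thesis by (simp add: free_lift_def)
qed

lemma (in group) free_lift_hom:
  assumes f: "f \<in> A \<rightarrow> carrier G"
  shows "free_lift G f \<in> hom (free_group A) G"
proof (rule homI)
  fix u v assume u: "u \<in> carrier (free_group A)" and v: "v \<in> carrier (free_group A)"
  have "free_lift G f (foldr push u v) = free_lift G f u \<otimes> free_lift G f v"
    if "fst ` set u \<subseteq> A" for u
    using that
  proof (induction u)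
    case Nil
    then show ?case using v free_lift_closed[OF f, of v] by (simp add: free_lift_def free_group_def)
  next
    case (Cons l u)
    have "fst ` set (foldr push u v) \<subseteq> A"
      using Cons.prems v set_foldr_push[of u v] by (force simp: free_group_def)
    then have "free_lift G f (foldr push (l # u) v)
        = letter_val G f l \<otimes> free_lift G f (foldr push u v)"
      using Cons.prems by (simp add: free_lift_push[OF f])
    also have "\<dots> = letter_val G f l \<otimes> (free_lift G f u \<otimes> free_lift G f v)"
      using Cons by simp
    also have "\<dots> = free_lift G f (l # u) \<otimes> free_lift G f v"
    proof -
      have "free_lift G f u \<in> carrier G" "free_lift G f v \<in> carrier G" "letter_val G f l \<in> carrier G"
        using Cons.prems v by (auto simp: free_group_def intro!: free_lift_closed[OF f] letter_val_closed[OF f])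
      then show ?thesis by (simp add: free_lift_Cons m_assoc)
    qed
    finally show ?case .
  qed
  then show "free_lift G f (u \<otimes>\<^bsub>free_group A\<^esub> v) = free_lift G f u \<otimes> free_lift G f v"
    using u by (simp add: free_group_def)
qed (use free_lift_closed[OF f] in \<open>auto simp: free_group_def\<close>)

lemma (in group) free_lift_gen: "f a \<in> carrier G \<Longrightarrow> free_lift G f (fg_gen a) = f a"
  by (simp add: free_lift_def fg_gen_def letter_val_def)


section \<open>Groups given by generators and relations\<close>

definition normal_closure :: "('g, 'm) monoid_scheme \<Rightarrow> 'g set \<Rightarrow> 'g set"
  where "normal_closure G R =
    generate G {g \<otimes>\<^bsub>G\<^esub> r \<otimes>\<^bsub>G\<^esub> inv\<^bsub>G\<^esub> g | g r. g \<in> carrier G \<and> r \<in> R}"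

text \<open>A pair \<open>(u, v)\<close> in \<open>R\<close> stands for the relation \<open>u = v\<close>.\<close>

definition relators :: "'x set \<Rightarrow> ('x letter list \<times> 'x letter list) set \<Rightarrow> 'x letter list set"
  where "relators X R =
    {u \<otimes>\<^bsub>free_group X\<^esub> inv\<^bsub>free_group X\<^esub> v | u v. (u, v) \<in> R}"

definition presented_group ::
    "'x set \<Rightarrow> ('x letter list \<times> 'x letter list) set \<Rightarrow> 'x letter list set monoid"
  where "presented_group X R = free_group X Mod normal_closure (free_group X) (relators X R)"

definition presented_gen ::
    "'x set \<Rightarrow> ('x letter list \<times> 'x letter list) set \<Rightarrow> 'x \<Rightarrow> 'x letter list set"
  where "presented_gen X R x =
    normal_closure (free_group X) (relators X R) #>\<^bsub>free_group X\<^esub> fg_gen x"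

text \<open>The homomorphism from a presented group to \<open>G\<close> that sends the generators to the values of
  \<open>f\<close>. It is only meaningful if \<open>f\<close> respects the relations: \<open>free_lift G f\<close> is then constant on the
  coset \<open>C\<close>, see \<open>presented_lift\<close> below.\<close>

definition presented_lift :: "('g, 'm) monoid_scheme \<Rightarrow> ('x \<Rightarrow> 'g) \<Rightarrow> 'x letter list set \<Rightarrow> 'g"
  where "presented_lift G f C = the_elem (free_lift G f ` C)"

lemma (in group) normal_closure_normal:
  assumes "R \<subseteq> carrier G"
  shows "normal_closure G R \<lhd> G"
  unfolding normal_closure_def
proof (rule normal_generateI)
  fix h g assume "h \<in> {g \<otimes> r \<otimes> inv g |g r. g \<in> carrier G \<and> r \<in> R}" and g: "g \<in> carrier G"
  then obtain k r where h: "h = k \<otimes> r \<otimes> inv k" "k \<in> carrier G" "r \<in> R" by blast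
  then have "g \<otimes> h \<otimes> inv g = (g \<otimes> k) \<otimes> r \<otimes> inv (g \<otimes> k)"
    using g assms by (auto simp: inv_mult_group m_assoc)
  then show "g \<otimes> h \<otimes> inv g \<in> {g \<otimes> r \<otimes> inv g |g r. g \<in> carrier G \<and> r \<in> R}"
    using g h by blast
qed (use assms in auto)

lemma relators_closed:
  assumes "R \<subseteq> carrier (free_group X) \<times> carrier (free_group X)"
  shows "relators X R \<subseteq> carrier (free_group X)"
proof -
  interpret F: group "free_group X" by (rule group_free_group)
  show ?thesis using assms by (auto simp: relators_def)
qed

lemma group_presented_group:
  assumes "R \<subseteq> carrier (free_group X) \<times> carrier (free_group X)"
  shows "group (presented_group X R)"
  unfolding presented_group_def
  by (intro normal.factorgroup_is_group group.normal_closure_normal group_free_group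
      relators_closed assms)

lemma (in group) presented_lift:
  assumes f: "f \<in> X \<rightarrow> carrier G"
    and R: "R \<subseteq> carrier (free_group X) \<times> carrier (free_group X)"
    and rel: "\<And>u v. (u, v) \<in> R \<Longrightarrow> free_lift G f u = free_lift G f v"
  shows presented_lift_coset: "\<And>w. w \<in> carrier (free_group X) \<Longrightarrow>
      presented_lift G f (normal_closure (free_group X) (relators X R) #>\<^bsub>free_group X\<^esub> w)
        = free_lift G f w"
    and presented_lift_gen: "\<And>x. x \<in> X \<Longrightarrow> presented_lift G f (presented_gen X R x) = f x"
    and presented_lift_hom: "presented_lift G f \<in> hom (presented_group X R) G"
    and presented_lift_const: "\<And>C w. \<lbrakk>C \<in> carrier (presented_group X R); w \<in> C\<rbrakk> \<Longrightarrow>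
      presented_lift G f C = free_lift G f w"
proof -
  let ?F = "free_group X" and ?N = "normal_closure (free_group X) (relators X R)"
  interpret F: group ?F by (rule group_free_group)
  interpret N: normal ?N ?F by (intro F.normal_closure_normal relators_closed R)
  interpret h: group_hom ?F G "free_lift G f"
    by unfold_locales (rule free_lift_hom[OF f])
  have "?N \<subseteq> kernel ?F G (free_lift G f)"
    unfolding normal_closure_def
  proof (rule F.generate_subgroup_incl[OF _ h.subgroup_kernel], safe)
    fix g r assume g: "g \<in> carrier ?F" and r: "r \<in> relators X R"
    then obtain u v where uv: "(u, v) \<in> R" "r = u \<otimes>\<^bsub>?F\<^esub> inv\<^bsub>?F\<^esub> v" by (auto simp: relators_def)
    then have c: "u \<in> carrier ?F" "v \<in> carrier ?F" using R by auto
    with uv rel[OF uv(1)] have "free_lift G f r = \<one>" by simp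
    with g c uv show "g \<otimes>\<^bsub>?F\<^esub> r \<otimes>\<^bsub>?F\<^esub> inv\<^bsub>?F\<^esub> g \<in> kernel ?F G (free_lift G f)"
      by (simp add: kernel_def)
  qed
  then have one: "free_lift G f n = \<one>" if "n \<in> ?N" for n using that by (auto simp: kernel_def)
  have const: "free_lift G f v = free_lift G f w" if "w \<in> carrier ?F" "v \<in> ?N #>\<^bsub>?F\<^esub> w" for v w
  proof -
    obtain n where n: "n \<in> ?N" "v = n \<otimes>\<^bsub>?F\<^esub> w" using \<open>v \<in> _\<close> unfolding r_coset_def by blast
    then show ?thesis using one[OF n(1)] that N.mem_carrier[OF n(1)] by simp
  qed
  have self: "w \<in> ?N #>\<^bsub>?F\<^esub> w" if "w \<in> carrier ?F" for w
    using that by (simp add: F.rcos_self N.is_subgroup)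
  show coset: "presented_lift G f (?N #>\<^bsub>?F\<^esub> w) = free_lift G f w" if "w \<in> carrier ?F" for w
    unfolding presented_lift_def
    by (rule the_elem_image_unique) (use self[OF that] const[OF that] in blast)+
  show "presented_lift G f C = free_lift G f w"
    if C: "C \<in> carrier (presented_group X R)" and w: "w \<in> C" for C w
  proof -
    obtain v where v: "v \<in> carrier ?F" "C = ?N #>\<^bsub>?F\<^esub> v"
      using C unfolding presented_group_def carrier_FactGroup by blast
    with w show ?thesis by (simp add: coset const[OF v(1)])
  qed
  show "presented_lift G f (presented_gen X R x) = f x" if "x \<in> X" for x
    unfolding presented_gen_def coset[OF fg_gen_in_free_group[OF that]]
    by (rule free_lift_gen) (use f that in blast)
  show "presented_lift G f \<in> hom (presented_group X R) G"
  proof (rule homI)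
    fix C D assume "C \<in> carrier (presented_group X R)" "D \<in> carrier (presented_group X R)"
    then obtain v w where vw: "v \<in> carrier ?F" "C = ?N #>\<^bsub>?F\<^esub> v" "w \<in> carrier ?F" "D = ?N #>\<^bsub>?F\<^esub> w"
      unfolding presented_group_def carrier_FactGroup by blast
    then show "presented_lift G f C \<in> carrier G"
      and "presented_lift G f (C \<otimes>\<^bsub>presented_group X R\<^esub> D) = presented_lift G f C \<otimes> presented_lift G f D"
      by (simp_all add: presented_group_def coset N.rcos_sum)
  qed
qed


section \<open>Racks and quandles\<close>

record 'a rack = "'a partial_object" +
  rop :: "'a \<Rightarrow> 'a \<Rightarrow> 'a" (infixl "\<triangleleft>\<index>" 70)
  rop_inv :: "'a \<Rightarrow> 'a \<Rightarrow> 'a" (infixl "\<triangleleft>\<^sup>-\<index>" 70)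

locale rack =
  fixes X (structure)
  assumes rop_closed: "\<lbrakk>x \<in> carrier X; y \<in> carrier X\<rbrakk> \<Longrightarrow> x \<triangleleft> y \<in> carrier X"
    and rop_inv_closed: "\<lbrakk>x \<in> carrier X; y \<in> carrier X\<rbrakk> \<Longrightarrow> x \<triangleleft>\<^sup>- y \<in> carrier X"
    and rop_inv_rop: "\<lbrakk>x \<in> carrier X; y \<in> carrier X\<rbrakk> \<Longrightarrow> (x \<triangleleft> y) \<triangleleft>\<^sup>- y = x"
    and rop_rop_inv: "\<lbrakk>x \<in> carrier X; y \<in> carrier X\<rbrakk> \<Longrightarrow> (x \<triangleleft>\<^sup>- y) \<triangleleft> y = x"
    and self_distrib: "\<lbrakk>x \<in> carrier X; y \<in> carrier X; z \<in> carrier X\<rbrakk> \<Longrightarrow>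
      (x \<triangleleft> y) \<triangleleft> z = (x \<triangleleft> z) \<triangleleft> (y \<triangleleft> z)"

locale quandle = rack +
  assumes idem: "x \<in> carrier X \<Longrightarrow> x \<triangleleft> x = x"

text \<open>The product is written for right actions: \<open>f \<otimes> g\<close> applies \<open>f\<close> first.\<close>

definition rack_Aut :: "('a, 'm) rack_scheme \<Rightarrow> ('a \<Rightarrow> 'a) monoid"
  where "rack_Aut X =
    \<lparr>carrier = {f \<in> Bij (carrier X).
        \<forall>x\<in>carrier X. \<forall>y\<in>carrier X. f (x \<triangleleft>\<^bsub>X\<^esub> y) = f x \<triangleleft>\<^bsub>X\<^esub> f y},
      monoid.mult = (\<lambda>f g. compose (carrier X) g f), one = (\<lambda>x\<in>carrier X. x)\<rparr>"

definition rack_S :: "('a, 'm) rack_scheme \<Rightarrow> 'a \<Rightarrow> 'a \<Rightarrow> 'a"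
  where "rack_S X y = (\<lambda>x\<in>carrier X. x \<triangleleft>\<^bsub>X\<^esub> y)"

definition Inn :: "('a, 'm) rack_scheme \<Rightarrow> ('a \<Rightarrow> 'a) monoid"
  where "Inn X = subgroup_generated (rack_Aut X) (rack_S X ` carrier X)"

definition Inn0 :: "('a, 'm) rack_scheme \<Rightarrow> ('a \<Rightarrow> 'a) monoid"
  where "Inn0 X = subgroup_generated (Inn X)
    {rack_S X a \<otimes>\<^bsub>Inn X\<^esub> inv\<^bsub>Inn X\<^esub> rack_S X b | a b. a \<in> carrier X \<and> b \<in> carrier X}"

definition Pth_rels :: "('a, 'm) rack_scheme \<Rightarrow> ('a letter list \<times> 'a letter list) set"
  where "Pth_rels X = {(fg_gen (x \<triangleleft>\<^bsub>X\<^esub> a),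
      inv\<^bsub>free_group (carrier X)\<^esub> fg_gen a \<otimes>\<^bsub>free_group (carrier X)\<^esub> fg_gen x
        \<otimes>\<^bsub>free_group (carrier X)\<^esub> fg_gen a) | x a. x \<in> carrier X \<and> a \<in> carrier X}"

definition Pth :: "('a, 'm) rack_scheme \<Rightarrow> 'a letter list set monoid"
  where "Pth X = presented_group (carrier X) (Pth_rels X)"

definition Pth_gen :: "('a, 'm) rack_scheme \<Rightarrow> 'a \<Rightarrow> 'a letter list set"
  where "Pth_gen X = presented_gen (carrier X) (Pth_rels X)"

definition Pth0 :: "('a, 'm) rack_scheme \<Rightarrow> 'a letter list set monoid"
  where "Pth0 X = (Pth X)
    \<lparr>carrier := kernel (Pth X) integer_group (presented_lift integer_group (\<lambda>_. 1))\<rparr>"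

text \<open>The right action of \<open>Pth X\<close> on \<open>X\<close> by \<open>x \<cdot> Pth_gen X y = x \<triangleleft> y\<close>: the letters of any word
  that represents the coset \<open>C\<close> are applied from left to right. The result does not depend on the
  word, see \<open>Pth_act_eq\<close> below.\<close>

definition word_act :: "('a, 'm) rack_scheme \<Rightarrow> 'a \<Rightarrow> 'a letter list \<Rightarrow> 'a"
  where "word_act X = foldl (\<lambda>x (y, b). if b then x \<triangleleft>\<^bsub>X\<^esub> y else x \<triangleleft>\<^sup>-\<^bsub>X\<^esub> y)"

definition Pth_act :: "('a, 'm) rack_scheme \<Rightarrow> 'a \<Rightarrow> 'a letter list set \<Rightarrow> 'a"
  where "Pth_act X x C = the_elem (word_act X x ` C)"

definition Pth_to_Inn :: "('a, 'm) rack_scheme \<Rightarrow> 'a letter list set \<Rightarrow> 'a \<Rightarrow> 'a"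
  where "Pth_to_Inn X = presented_lift (Inn X) (rack_S X)"

text \<open>This includes that \<open>act\<close> is a right action of \<open>G\<close> on \<open>E\<close>.\<close>

definition acts_freely :: "('g, 'm) monoid_scheme \<Rightarrow> 'x set \<Rightarrow> ('x \<Rightarrow> 'g \<Rightarrow> 'x) \<Rightarrow> bool"
  where "acts_freely G E act \<longleftrightarrow>
    (\<forall>x\<in>E. \<forall>g\<in>carrier G. act x g \<in> E) \<and>
    (\<forall>x\<in>E. act x \<one>\<^bsub>G\<^esub> = x) \<and>
    (\<forall>x\<in>E. \<forall>g\<in>carrier G. \<forall>h\<in>carrier G. act x (g \<otimes>\<^bsub>G\<^esub> h) = act (act x g) h) \<and>
    (\<forall>x\<in>E. \<forall>g\<in>carrier G. act x g = x \<longrightarrow> g = \<one>\<^bsub>G\<^esub>)"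

lemma (in rack) Pth_rels_closed:
  "Pth_rels X \<subseteq> carrier (free_group (carrier X)) \<times> carrier (free_group (carrier X))"
proof -
  interpret F: group "free_group (carrier X)" by (rule group_free_group)
  show ?thesis by (auto simp: Pth_rels_def rop_closed fg_gen_in_free_group)
qed

lemma (in rack) group_Pth: "group (Pth X)"
  unfolding Pth_def by (rule group_presented_group[OF Pth_rels_closed])

lemma (in rack) Pth_degree:
  shows Pth_degree_hom: "presented_lift integer_group (\<lambda>_. 1) \<in> hom (Pth X) integer_group"
    and Pth_degree_gen: "\<And>x. x \<in> carrier X \<Longrightarrow>
      presented_lift integer_group (\<lambda>_. 1) (Pth_gen X x) = 1"
proof -
  interpret Z: group integer_group by simp
  interpret F: group "free_group (carrier X)" by (rule group_free_group)
  let ?d = "free_lift integer_group (\<lambda>_. 1) :: 'a letter list \<Rightarrow> int"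
  interpret d: group_hom "free_group (carrier X)" integer_group ?d
    by unfold_locales (rule Z.free_lift_hom, simp)
  have gen: "?d (fg_gen x) = 1" for x using Z.free_lift_gen[of "\<lambda>_. 1" x] by simp
  have rel: "?d u = ?d v" if uv: "(u, v) \<in> Pth_rels X" for u v
  proof -
    obtain x a where xa: "x \<in> carrier X" "a \<in> carrier X" "u = fg_gen (x \<triangleleft> a)"
        "v = inv\<^bsub>free_group (carrier X)\<^esub> fg_gen a \<otimes>\<^bsub>free_group (carrier X)\<^esub> fg_gen x
          \<otimes>\<^bsub>free_group (carrier X)\<^esub> fg_gen a"
      using uv by (auto simp: Pth_rels_def)
    have "fg_gen x \<in> carrier (free_group (carrier X))" "fg_gen a \<in> carrier (free_group (carrier X))"
      using xa by (simp_all add: fg_gen_in_free_group)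
    then show ?thesis by (simp add: xa gen)
  qed
  have f: "(\<lambda>_. 1) \<in> carrier X \<rightarrow> carrier integer_group" by simp
  show "presented_lift integer_group (\<lambda>_. 1) \<in> hom (Pth X) integer_group"
    unfolding Pth_def using f Pth_rels_closed rel by (rule Z.presented_lift_hom)
  show "presented_lift integer_group (\<lambda>_. 1) (Pth_gen X x) = 1" if "x \<in> carrier X" for x
    unfolding Pth_gen_def using f Pth_rels_closed rel that by (rule Z.presented_lift_gen)
qed

lemma (in rack) group_rack_Aut: "group (rack_Aut X)"
proof (rule groupI)
  fix f assume "f \<in> carrier (rack_Aut X)"
  then have f: "f \<in> Bij (carrier X)"
    and hom: "\<And>x y. \<lbrakk>x \<in> carrier X; y \<in> carrier X\<rbrakk> \<Longrightarrow> f (x \<triangleleft> y) = f x \<triangleleft> f y"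
    by (auto simp: rack_Aut_def)
  let ?g = "\<lambda>x\<in>carrier X. inv_into (carrier X) f x"
  have bij: "bij_betw f (carrier X) (carrier X)" using f by (simp add: Bij_def)
  have "?g (x \<triangleleft> y) = ?g x \<triangleleft> ?g y" if xy: "x \<in> carrier X" "y \<in> carrier X" for x y
  proof -
    obtain u v where uv: "u \<in> carrier X" "v \<in> carrier X" "x = f u" "y = f v"
      using xy bij by (metis bij_betw_imp_surj_on imageE)
    have "?g x = u" "?g y = v" "?g (f (u \<triangleleft> v)) = u \<triangleleft> v"
      using uv xy bij bij_betwE[OF bij]
      by (auto simp: bij_betw_inv_into_left rop_closed)
    then show ?thesis using uv hom by simp
  qed
  moreover have "?g \<in> Bij (carrier X)" by (rule restrict_inv_into_Bij[OF f])
  moreover have "compose (carrier X) f ?g = (\<lambda>x\<in>carrier X. x)"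
    using bij by (auto simp: compose_def fun_eq_iff bij_betw_inv_into_right)
  ultimately show "\<exists>g\<in>carrier (rack_Aut X). g \<otimes>\<^bsub>rack_Aut X\<^esub> f = \<one>\<^bsub>rack_Aut X\<^esub>"
    by (intro bexI[of _ ?g]) (auto simp: rack_Aut_def)
next
  fix f g assume "f \<in> carrier (rack_Aut X)" "g \<in> carrier (rack_Aut X)"
  then have f: "f \<in> Bij (carrier X)" and g: "g \<in> Bij (carrier X)"
    and hom: "\<And>x y. \<lbrakk>x \<in> carrier X; y \<in> carrier X\<rbrakk> \<Longrightarrow> f (x \<triangleleft> y) = f x \<triangleleft> f y"
      "\<And>x y. \<lbrakk>x \<in> carrier X; y \<in> carrier X\<rbrakk> \<Longrightarrow> g (x \<triangleleft> y) = g x \<triangleleft> g y"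
    by (auto simp: rack_Aut_def)
  have "f x \<in> carrier X" if "x \<in> carrier X" for x
    using Bij_imp_funcset[OF f] that by auto
  with f g show "f \<otimes>\<^bsub>rack_Aut X\<^esub> g \<in> carrier (rack_Aut X)"
    by (simp add: rack_Aut_def compose_Bij compose_eq rop_closed hom)
next
  fix f g h assume "f \<in> carrier (rack_Aut X)" "g \<in> carrier (rack_Aut X)" "h \<in> carrier (rack_Aut X)"
  then show "f \<otimes>\<^bsub>rack_Aut X\<^esub> g \<otimes>\<^bsub>rack_Aut X\<^esub> h = f \<otimes>\<^bsub>rack_Aut X\<^esub> (g \<otimes>\<^bsub>rack_Aut X\<^esub> h)"
    using Bij_imp_funcset[of f "carrier X"]
    by (auto simp: rack_Aut_def compose_assoc)
next
  fix f assume "f \<in> carrier (rack_Aut X)"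
  then have f: "f \<in> Bij (carrier X)" by (simp add: rack_Aut_def)
  show "\<one>\<^bsub>rack_Aut X\<^esub> \<otimes>\<^bsub>rack_Aut X\<^esub> f = f"
    using compose_Id[OF Bij_imp_funcset[OF f] Bij_imp_extensional[OF f]]
    by (simp add: rack_Aut_def)
qed (auto simp: rack_Aut_def id_Bij rop_closed)

lemma (in rack) rack_S_in_Aut:
  assumes "y \<in> carrier X" shows "rack_S X y \<in> carrier (rack_Aut X)"
proof -
  have "bij_betw (rack_S X y) (carrier X) (carrier X)"
    by (rule bij_betwI[where g = "\<lambda>x. x \<triangleleft>\<^sup>- y"])
       (use assms in \<open>auto simp: rack_S_def rop_closed rop_inv_closed rop_inv_rop rop_rop_inv\<close>)
  then show ?thesis
    using assms self_distrib[OF _ _ assms]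
    by (auto simp: rack_Aut_def Bij_def rack_S_def rop_closed)
qed

lemma (in rack) rack_S_in_Inn: "y \<in> carrier X \<Longrightarrow> rack_S X y \<in> carrier (Inn X)"
  unfolding Inn_def carrier_subgroup_generated
  by (auto intro!: generate.incl rack_S_in_Aut)

lemma (in rack) group_Inn: "group (Inn X)"
proof -
  interpret A: group "rack_Aut X" by (rule group_rack_Aut)
  show ?thesis unfolding Inn_def by simp
qed

lemma (in rack) Inn_subset_Aut: "carrier (Inn X) \<subseteq> carrier (rack_Aut X)"
  unfolding Inn_def by (rule group.carrier_subgroup_generated_subset[OF group_rack_Aut])

lemma (in rack) Inn_mult:
  "f \<otimes>\<^bsub>Inn X\<^esub> g = compose (carrier X) g f" "\<one>\<^bsub>Inn X\<^esub> = (\<lambda>x\<in>carrier X. x)"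
  by (simp_all add: Inn_def rack_Aut_def)

lemma (in rack) Inn_inv_S:
  assumes "y \<in> carrier X"
  shows "inv\<^bsub>Inn X\<^esub> rack_S X y = (\<lambda>x\<in>carrier X. x \<triangleleft>\<^sup>- y)"
proof -
  interpret I: group "Inn X" by (rule group_Inn)
  let ?s = "rack_S X y" and ?t = "inv\<^bsub>Inn X\<^esub> rack_S X y"
  have s: "?s \<in> carrier (Inn X)" by (rule rack_S_in_Inn[OF assms])
  then have t: "?t \<in> carrier (rack_Aut X)" using Inn_subset_Aut by auto
  then have ext: "?t \<in> extensional (carrier X)" and cl: "\<And>x. x \<in> carrier X \<Longrightarrow> ?t x \<in> carrier X"
    using Bij_imp_extensional Bij_imp_funcset by (fastforce simp: rack_Aut_def)+
  have eq: "compose (carrier X) ?s ?t = (\<lambda>x\<in>carrier X. x)"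
    using I.l_inv[OF s] by (simp add: Inn_mult)
  show ?thesis
  proof (rule extensionalityI[OF ext])
    fix x assume x: "x \<in> carrier X"
    have "?t x \<triangleleft> y = x"
      using fun_cong[OF eq, of x] x cl by (simp add: compose_def rack_S_def)
    then show "?t x = (\<lambda>x\<in>carrier X. x \<triangleleft>\<^sup>- y) x"
      using rop_inv_rop[OF cl[OF x] assms] x by simp
  qed simp
qed

lemma (in rack) Pth_to_Inn:
  shows Pth_to_Inn_hom: "Pth_to_Inn X \<in> hom (Pth X) (Inn X)"
    and Pth_to_Inn_gen: "\<And>y. y \<in> carrier X \<Longrightarrow> Pth_to_Inn X (Pth_gen X y) = rack_S X y"
    and Pth_to_Inn_const: "\<And>C w. \<lbrakk>C \<in> carrier (Pth X); w \<in> C\<rbrakk> \<Longrightarrow>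
      Pth_to_Inn X C = free_lift (Inn X) (rack_S X) w"
proof -
  interpret I: group "Inn X" by (rule group_Inn)
  interpret F: group "free_group (carrier X)" by (rule group_free_group)
  have S: "rack_S X \<in> carrier X \<rightarrow> carrier (Inn X)" using rack_S_in_Inn by auto
  interpret h: group_hom "free_group (carrier X)" "Inn X" "free_lift (Inn X) (rack_S X)"
    by unfold_locales (rule I.free_lift_hom[OF S])
  have rel: "free_lift (Inn X) (rack_S X) u = free_lift (Inn X) (rack_S X) v"
    if uv: "(u, v) \<in> Pth_rels X" for u v
  proof -
    obtain x a where xa: "x \<in> carrier X" "a \<in> carrier X" "u = fg_gen (x \<triangleleft> a)"
        "v = inv\<^bsub>free_group (carrier X)\<^esub> fg_gen a \<otimes>\<^bsub>free_group (carrier X)\<^esub> fg_gen x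
          \<otimes>\<^bsub>free_group (carrier X)\<^esub> fg_gen a"
      using uv by (auto simp: Pth_rels_def)
    have c: "fg_gen x \<in> carrier (free_group (carrier X))" "fg_gen a \<in> carrier (free_group (carrier X))"
      using xa by (simp_all add: fg_gen_in_free_group)
    have "z \<triangleleft> (x \<triangleleft> a) = z \<triangleleft>\<^sup>- a \<triangleleft> x \<triangleleft> a" if "z \<in> carrier X" for z
      using that xa self_distrib[OF rop_inv_closed, of z a x a] by (simp add: rop_rop_inv)
    then have "rack_S X (x \<triangleleft> a)
        = inv\<^bsub>Inn X\<^esub> rack_S X a \<otimes>\<^bsub>Inn X\<^esub> rack_S X x \<otimes>\<^bsub>Inn X\<^esub> rack_S X a"
      using xa unfolding Inn_mult Inn_inv_S[OF xa(2)]
      by (intro ext) (simp add: compose_def rack_S_def rop_closed rop_inv_closed)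
    then show ?thesis
      using c xa by (simp add: I.free_lift_gen rack_S_in_Inn rop_closed)
  qed
  show "Pth_to_Inn X \<in> hom (Pth X) (Inn X)"
    unfolding Pth_def Pth_to_Inn_def using S Pth_rels_closed rel by (rule I.presented_lift_hom)
  show "Pth_to_Inn X (Pth_gen X y) = rack_S X y" if "y \<in> carrier X" for y
    unfolding Pth_gen_def Pth_to_Inn_def using S Pth_rels_closed rel that by (rule I.presented_lift_gen)
  show "Pth_to_Inn X C = free_lift (Inn X) (rack_S X) w" if "C \<in> carrier (Pth X)" "w \<in> C" for C w
    unfolding Pth_def Pth_to_Inn_def
    using S Pth_rels_closed rel that[unfolded Pth_def] by (rule I.presented_lift_const)
qed

lemma (in rack) word_act:
  assumes "x \<in> carrier X" "fst ` set w \<subseteq> carrier X"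
  shows "word_act X x w = free_lift (Inn X) (rack_S X) w x"
  using assms
proof (induction w arbitrary: x)
  case (Cons l w)
  obtain y b where l: "l = (y, b)" by fastforce
  have "letter_val (Inn X) (rack_S X) l x = (if b then x \<triangleleft> y else x \<triangleleft>\<^sup>- y)"
    using Cons.prems by (auto simp: letter_val_def l Inn_inv_S) (simp add: rack_S_def)
  moreover have "(if b then x \<triangleleft> y else x \<triangleleft>\<^sup>- y) \<in> carrier X"
    using Cons.prems by (auto simp: l rop_closed rop_inv_closed)
  ultimately show ?case
    using Cons by (cases b) (simp_all add: free_lift_Cons Inn_mult compose_def word_act_def l)
qed (simp add: word_act_def free_lift_def Inn_mult)

lemma (in rack) Pth_act_eq:
  assumes x: "x \<in> carrier X" and C: "C \<in> carrier (Pth X)"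
  shows "Pth_act X x C = Pth_to_Inn X C x"
proof -
  interpret F: group "free_group (carrier X)" by (rule group_free_group)
  interpret N: normal "normal_closure (free_group (carrier X)) (relators (carrier X) (Pth_rels X))"
      "free_group (carrier X)"
    by (intro F.normal_closure_normal relators_closed Pth_rels_closed)
  have sub: "C \<subseteq> carrier (free_group (carrier X))" and ne: "C \<noteq> {}"
    using C N.subset F.r_coset_subset_G F.rcos_self N.is_subgroup
    unfolding Pth_def presented_group_def carrier_FactGroup by blast+
  have "word_act X x w = Pth_to_Inn X C x" if "w \<in> C" for w
  proof -
    have "fst ` set w \<subseteq> carrier X" using that sub by (auto simp: free_group_def)
    then show ?thesis using Pth_to_Inn_const[OF C that] word_act[OF x] by simp
  qed
  with ne show ?thesis
    unfolding Pth_act_def by (metis (no_types, lifting) ex_in_conv the_elem_image_unique)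
qed


section \<open>Free quandles\<close>

text \<open>\<open>rop_inv\<close> is forced by \<open>rop\<close>, see \<open>quandle_free_quandle\<close> below.\<close>

definition free_quandle :: "'a set \<Rightarrow> ('a \<times> 'a letter list) rack"
  where "free_quandle A =
    \<lparr>carrier = A \<times> carrier (free_group0 A),
     rop = (\<lambda>(a, g) (b, h). (a,
       inv\<^bsub>free_group A\<^esub> fg_gen a \<otimes>\<^bsub>free_group A\<^esub> g \<otimes>\<^bsub>free_group A\<^esub> inv\<^bsub>free_group A\<^esub> h
         \<otimes>\<^bsub>free_group A\<^esub> fg_gen b \<otimes>\<^bsub>free_group A\<^esub> h)),
     rop_inv = (\<lambda>(a, g) (b, h). (a,
       fg_gen a \<otimes>\<^bsub>free_group A\<^esub> g \<otimes>\<^bsub>free_group A\<^esub> inv\<^bsub>free_group A\<^esub> h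
         \<otimes>\<^bsub>free_group A\<^esub> inv\<^bsub>free_group A\<^esub> fg_gen b \<otimes>\<^bsub>free_group A\<^esub> h))\<rparr>"

definition free_quandle_unit :: "'a set \<Rightarrow> 'a \<Rightarrow> 'a \<times> 'a letter list"
  where "free_quandle_unit A a = (a, \<one>\<^bsub>free_group A\<^esub>)"

definition free_quandle_act ::
    "'a set \<Rightarrow> 'a \<times> 'a letter list \<Rightarrow> 'a letter list \<Rightarrow> 'a \<times> 'a letter list"
  where "free_quandle_act A x h = (fst x, snd x \<otimes>\<^bsub>free_group A\<^esub> h)"

definition free_to_Pth :: "'a set \<Rightarrow> 'a letter list \<Rightarrow> ('a \<times> 'a letter list) letter list set"
  where "free_to_Pth A =
    free_lift (Pth (free_quandle A)) (\<lambda>a. Pth_gen (free_quandle A) (free_quandle_unit A a))"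

lemma quandle_free_quandle: "quandle (free_quandle A)"
proof -
  let ?F = "free_group A" and ?Q = "free_quandle A" and ?d = "free_lift integer_group (\<lambda>_. 1)"
  interpret F: group ?F by (rule group_free_group)
  interpret Z: group integer_group by simp
  interpret d: group_hom ?F integer_group ?d
    by unfold_locales (rule Z.free_lift_hom, simp)
  have gen [simp]: "?d (fg_gen a) = 1" for a using Z.free_lift_gen[of "\<lambda>_. 1" a] by simp
  have Q: "x \<in> carrier ?Q \<longleftrightarrow> (fst x \<in> A \<and> fg_gen (fst x) \<in> carrier ?F \<and> snd x \<in> carrier ?F
      \<and> ?d (snd x) = 0)" for x
    by (cases x) (auto simp: free_quandle_def free_group0_def kernel_def fg_gen_in_free_group)
  note defs = free_quandle_def split_beta
  have canc: "x \<otimes>\<^bsub>?F\<^esub> (inv\<^bsub>?F\<^esub> x \<otimes>\<^bsub>?F\<^esub> y) = y" "inv\<^bsub>?F\<^esub> x \<otimes>\<^bsub>?F\<^esub> (x \<otimes>\<^bsub>?F\<^esub> y) = y"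
    if "x \<in> carrier ?F" "y \<in> carrier ?F" for x y
    using that by (simp_all flip: F.m_assoc)
  show ?thesis
  proof
    fix x y z assume "x \<in> carrier ?Q" "y \<in> carrier ?Q" "z \<in> carrier ?Q"
    then show "x \<triangleleft>\<^bsub>?Q\<^esub> y \<triangleleft>\<^bsub>?Q\<^esub> z = x \<triangleleft>\<^bsub>?Q\<^esub> z \<triangleleft>\<^bsub>?Q\<^esub> (y \<triangleleft>\<^bsub>?Q\<^esub> z)"
      unfolding Q by (simp add: defs F.m_assoc F.inv_mult_group canc)
  next
    fix x y assume xy: "x \<in> carrier ?Q" "y \<in> carrier ?Q"
    show "x \<triangleleft>\<^bsub>?Q\<^esub> y \<in> carrier ?Q"
      using xy unfolding Q by (simp add: defs)
    show "x \<triangleleft>\<^sup>-\<^bsub>?Q\<^esub> y \<in> carrier ?Q"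
      using xy unfolding Q by (simp add: defs)
    show "x \<triangleleft>\<^bsub>?Q\<^esub> y \<triangleleft>\<^sup>-\<^bsub>?Q\<^esub> y = x"
      using xy unfolding Q by (simp add: defs F.m_assoc canc)
    show "x \<triangleleft>\<^sup>-\<^bsub>?Q\<^esub> y \<triangleleft>\<^bsub>?Q\<^esub> y = x"
      using xy unfolding Q by (simp add: defs F.m_assoc canc)
  next
    fix x assume "x \<in> carrier ?Q"
    then show "x \<triangleleft>\<^bsub>?Q\<^esub> x = x"
      unfolding Q by (simp add: defs F.m_assoc canc)
  qed
qed

lemma free_quandle_unit_in: "a \<in> A \<Longrightarrow> free_quandle_unit A a \<in> carrier (free_quandle A)"
  by (simp add: free_quandle_unit_def free_quandle_def free_group0_def kernel_def free_group_def
      free_lift_def)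

lemma free_to_Pth:
  shows free_to_Pth_hom: "free_to_Pth A \<in> hom (free_group A) (Pth (free_quandle A))"
    and free_to_Pth_gen: "a \<in> A \<Longrightarrow>
      free_to_Pth A (fg_gen a) = Pth_gen (free_quandle A) (free_quandle_unit A a)"
proof -
  let ?Q = "free_quandle A"
  interpret Q: quandle ?Q by (rule quandle_free_quandle)
  interpret P: group "Pth ?Q" by (rule Q.group_Pth)
  have "Pth_gen ?Q x \<in> carrier (Pth ?Q)" if "x \<in> carrier ?Q" for x
    using fg_gen_in_free_group[OF that]
    by (auto simp: Pth_gen_def Pth_def presented_gen_def presented_group_def carrier_FactGroup)
  then have *: "(\<lambda>a. Pth_gen ?Q (free_quandle_unit A a)) \<in> A \<rightarrow> carrier (Pth ?Q)"
    by (auto simp: free_quandle_unit_in)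
  show "free_to_Pth A \<in> hom (free_group A) (Pth ?Q)"
    unfolding free_to_Pth_def by (rule P.free_lift_hom[OF *])
  show "free_to_Pth A (fg_gen a) = Pth_gen ?Q (free_quandle_unit A a)" if "a \<in> A"
    unfolding free_to_Pth_def using * that by (intro P.free_lift_gen) auto
qed

end

theory Submission
  imports Defs
begin

text \<open>Write \<open>F = F\<^sub>g(A)\<close>, \<open>Q = F\<^sub>q(A)\<close> and \<open>e\<close> for the unit of \<open>F\<close>; \<open>deg\<close> is the homomorphism
  to the integers that sends all generators to \<open>1\<close>.

  The map \<open>F \<rightarrow> Pth(Q)\<close> is an isomorphism even before restriction to degree \<open>0\<close>. Its inverse
  sends the generator of \<open>Pth(Q)\<close> at \<open>(a, g)\<close> to \<open>g\<^sup>-\<^sup>1 a g\<close>: this respects the relations because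
  the formula for \<open>\<triangleleft>\<close> in \<open>Q\<close> is made for \<open>(a, g) \<mapsto> g\<^sup>-\<^sup>1 a g\<close> to turn \<open>\<triangleleft>\<close> into conjugation.
  One composite is the identity on \<open>F\<close> since it fixes the generators \<open>a\<close>. For the other, two
  facts are needed. In any rack \<open>X\<close>, the defining relations say that acting on a point by a
  generator conjugates the element of \<open>Pth(X)\<close> at that point, and hence acting by any \<open>p\<close>
  conjugates it by \<open>p\<close> (\<open>Pth_gen_equivariant\<close>). In \<open>Q\<close>, an element \<open>h\<close> of \<open>F\<close> acts through
  \<open>Pth(Q)\<close> by \<open>(a, g) \<mapsto> (a, a\<^sup>-\<^sup>d g h)\<close> with \<open>d = deg h\<close> (\<open>free_to_Pth_act\<close>); in degree \<open>0\<close> this is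
  the right translation by \<open>h\<close>. So \<open>(a, g)\<close> arises from \<open>(a, e)\<close> by the action of \<open>g\<close>, and the
  generator at \<open>(a, g)\<close> is the conjugate by the image of \<open>g\<close> of the generator at \<open>(a, e)\<close>, that
  is, the image of \<open>g\<^sup>-\<^sup>1 a g\<close>.

  For \<open>s\<close>, surjectivity onto \<open>Inn\<^sup>\<circ>\<close> holds for every rack: the kernel of the degree on
  \<open>Pth(X)\<close> is generated by the elements \<open>x y\<^sup>-\<^sup>1\<close> with \<open>x\<close>, \<open>y\<close> generators (\<open>Pth0_generate\<close>), and
  \<open>s\<close> sends these to the generators of \<open>Inn\<^sup>\<circ>(X)\<close>. Injectivity uses the shape of \<open>Q\<close>: on
  \<open>Pth\<^sup>\<circ>(Q)\<close> the map \<open>s\<close> is the action of \<open>F\<^sub>g\<^sup>\<circ>(A)\<close> by right translations of the second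
  component, and such a translation determines \<open>h\<close> by its value at a single point. The same
  cancellation shows that the action is free, and freeness is then transported along the two
  isomorphisms.\<close>

section \<open>Generators of free and presented groups\<close>

lemma (in group) cancel_inv_left:
  assumes "x \<in> carrier G" "y \<in> carrier G"
  shows "x \<otimes> (inv x \<otimes> y) = y" "inv x \<otimes> (x \<otimes> y) = y"
  using assms by (simp_all flip: m_assoc)

lemma hom_eq_on_generate:
  assumes "group_hom G H f" "group_hom G H g" "S \<subseteq> carrier G"
    and eq: "\<And>s. s \<in> S \<Longrightarrow> f s = g s" and x: "x \<in> generate G S"
  shows "f x = g x"
proof -
  interpret f: group_hom G H f by fact
  interpret g: group_hom G H g by fact
  show ?thesis
    using x
  proof (induction rule: generate.induct)
    case (eng x y)
    then have "x \<in> carrier G" "y \<in> carrier G"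
      using f.G.generate_in_carrier[OF \<open>S \<subseteq> carrier G\<close>] by auto
    with eng show ?case by simp
  qed (use assms(3) eq in auto)
qed

lemma inv_fg_gen:
  assumes "a \<in> A" shows "inv\<^bsub>free_group A\<^esub> fg_gen a = [(a, False)]"
proof -
  interpret F: group "free_group A" by (rule group_free_group)
  show ?thesis
    by (rule F.inv_equality)
       (use assms in \<open>auto simp: free_group_def fg_gen_def push_def letter_inv_def reduced_def\<close>)
qed

lemma free_group_generate: "carrier (free_group A) = generate (free_group A) (fg_gen ` A)"
proof
  interpret F: group "free_group A" by (rule group_free_group)
  show "generate (free_group A) (fg_gen ` A) \<subseteq> carrier (free_group A)"
    by (rule F.generate_incl) (auto simp: fg_gen_in_free_group)
  have "w \<in> generate (free_group A) (fg_gen ` A)" if "reduced w" "fst ` set w \<subseteq> A" for w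
    using that
  proof (induction w)
    case Nil
    show ?case
      using generate.one[of "free_group A"] by (simp add: free_group_def)
  next
    case (Cons l w)
    have "[l] \<in> generate (free_group A) (fg_gen ` A)"
    proof (cases "snd l")
      case True
      then have "[l] = fg_gen (fst l)" by (cases l) (simp add: fg_gen_def)
      then show ?thesis using Cons.prems by (auto intro: generate.incl)
    next
      case False
      then have "[l] = inv\<^bsub>free_group A\<^esub> fg_gen (fst l)"
        using Cons.prems by (cases l) (simp add: inv_fg_gen)
      then show ?thesis using Cons.prems by (auto intro: generate.inv)
    qed
    moreover have "w \<in> generate (free_group A) (fg_gen ` A)"
      using Cons.IH reduced_ConsD[OF Cons.prems(1)] Cons.prems(2) by simp
    ultimately have "[l] \<otimes>\<^bsub>free_group A\<^esub> w \<in> generate (free_group A) (fg_gen ` A)"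
      by (rule generate.eng)
    then show ?case
      using push_reduced[OF Cons.prems(1)] by (simp add: free_group_def)
  qed
  then show "carrier (free_group A) \<subseteq> generate (free_group A) (fg_gen ` A)"
    by (auto simp: free_group_def)
qed

lemma presented_quotient_group_hom:
  assumes "R \<subseteq> carrier (free_group X) \<times> carrier (free_group X)"
  shows "group_hom (free_group X) (presented_group X R)
    (\<lambda>w. normal_closure (free_group X) (relators X R) #>\<^bsub>free_group X\<^esub> w)"
proof -
  interpret F: group "free_group X" by (rule group_free_group)
  interpret N: normal "normal_closure (free_group X) (relators X R)" "free_group X"
    by (intro F.normal_closure_normal relators_closed assms)
  show ?thesis
    unfolding group_hom_def group_hom_axioms_def
    using N.r_coset_hom_Mod group_presented_group[OF assms]
    by (simp add: F.is_group presented_group_def)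
qed

lemma presented_group_generate:
  assumes "R \<subseteq> carrier (free_group X) \<times> carrier (free_group X)"
  shows "carrier (presented_group X R) = generate (presented_group X R) (presented_gen X R ` X)"
proof -
  let ?F = "free_group X" and ?N = "normal_closure (free_group X) (relators X R)"
  interpret q: group_hom ?F "presented_group X R" "\<lambda>w. ?N #>\<^bsub>?F\<^esub> w"
    by (rule presented_quotient_group_hom[OF assms])
  have "carrier (presented_group X R) = (\<lambda>w. ?N #>\<^bsub>?F\<^esub> w) ` generate ?F (fg_gen ` X)"
    by (auto simp: presented_group_def carrier_FactGroup simp flip: free_group_generate)
  also have "\<dots> = generate (presented_group X R) ((\<lambda>w. ?N #>\<^bsub>?F\<^esub> w) ` fg_gen ` X)"
    by (rule q.generate_img[symmetric]) (auto simp: fg_gen_in_free_group)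
  also have "(\<lambda>w. ?N #>\<^bsub>?F\<^esub> w) ` fg_gen ` X = presented_gen X R ` X"
    by (simp add: presented_gen_def image_image)
  finally show ?thesis .
qed

lemma presented_group_rel:
  assumes R: "R \<subseteq> carrier (free_group X) \<times> carrier (free_group X)" and uv: "(u, v) \<in> R"
  shows "normal_closure (free_group X) (relators X R) #>\<^bsub>free_group X\<^esub> u
    = normal_closure (free_group X) (relators X R) #>\<^bsub>free_group X\<^esub> v"
proof -
  let ?F = "free_group X" and ?N = "normal_closure (free_group X) (relators X R)"
  interpret F: group ?F by (rule group_free_group)
  interpret N: normal ?N ?F by (intro F.normal_closure_normal relators_closed R)
  have c: "u \<in> carrier ?F" "v \<in> carrier ?F" using R uv by auto
  let ?r = "u \<otimes>\<^bsub>?F\<^esub> inv\<^bsub>?F\<^esub> v"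
  have "?r \<in> relators X R" using uv by (auto simp: relators_def)
  then have "\<one>\<^bsub>?F\<^esub> \<otimes>\<^bsub>?F\<^esub> ?r \<otimes>\<^bsub>?F\<^esub> inv\<^bsub>?F\<^esub> \<one>\<^bsub>?F\<^esub> \<in> ?N"
    unfolding normal_closure_def by (blast intro: generate.incl)
  then have "?r \<in> ?N" using c by simp
  then have "?r \<otimes>\<^bsub>?F\<^esub> v \<in> ?N #>\<^bsub>?F\<^esub> v"
    using c(2) N.subset by (auto simp: r_coset_def)
  then have "u \<in> ?N #>\<^bsub>?F\<^esub> v" using c by (simp add: F.m_assoc)
  then show ?thesis using F.repr_independence N.is_subgroup c(2) by metis
qed

section \<open>The path group of a rack\<close>

context rack
begin

lemma Pth_gen_closed: "x \<in> carrier X \<Longrightarrow> Pth_gen X x \<in> carrier (Pth X)"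
  using fg_gen_in_free_group[of x "carrier X"]
  by (auto simp: Pth_gen_def Pth_def presented_gen_def presented_group_def carrier_FactGroup)

lemma Pth_generate: "carrier (Pth X) = generate (Pth X) (Pth_gen X ` carrier X)"
  unfolding Pth_def Pth_gen_def by (rule presented_group_generate[OF Pth_rels_closed])

lemma Pth_gen_rop:
  assumes "x \<in> carrier X" "a \<in> carrier X"
  shows "Pth_gen X (x \<triangleleft> a) = inv\<^bsub>Pth X\<^esub> Pth_gen X a \<otimes>\<^bsub>Pth X\<^esub> Pth_gen X x \<otimes>\<^bsub>Pth X\<^esub> Pth_gen X a"
proof -
  let ?F = "free_group (carrier X)"
  let ?N = "normal_closure ?F (relators (carrier X) (Pth_rels X))"
  interpret q: group_hom ?F "Pth X" "\<lambda>w. ?N #>\<^bsub>?F\<^esub> w"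
    unfolding Pth_def by (rule presented_quotient_group_hom[OF Pth_rels_closed])
  have "Pth_gen X (x \<triangleleft> a) = ?N #>\<^bsub>?F\<^esub> (inv\<^bsub>?F\<^esub> fg_gen a \<otimes>\<^bsub>?F\<^esub> fg_gen x \<otimes>\<^bsub>?F\<^esub> fg_gen a)"
    unfolding Pth_gen_def presented_gen_def
    by (rule presented_group_rel[OF Pth_rels_closed]) (use assms in \<open>auto simp: Pth_rels_def\<close>)
  also have "\<dots> = inv\<^bsub>Pth X\<^esub> Pth_gen X a \<otimes>\<^bsub>Pth X\<^esub> Pth_gen X x \<otimes>\<^bsub>Pth X\<^esub> Pth_gen X a"
    using assms by (simp add: fg_gen_in_free_group Pth_gen_def presented_gen_def)
  finally show ?thesis .
qed

text \<open>The universal property of \<open>Pth X\<close>: \<open>Pth\<close> is left adjoint to the functor that takes a group to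
  its conjugation quandle, regarded as a rack.\<close>

lemma Pth_lift:
  assumes "group G" and f: "f \<in> carrier X \<rightarrow> carrier G"
    and rop: "\<And>x a. \<lbrakk>x \<in> carrier X; a \<in> carrier X\<rbrakk> \<Longrightarrow>
      f (x \<triangleleft> a) = inv\<^bsub>G\<^esub> f a \<otimes>\<^bsub>G\<^esub> f x \<otimes>\<^bsub>G\<^esub> f a"
  shows Pth_lift_hom: "presented_lift G f \<in> hom (Pth X) G"
    and Pth_lift_gen: "\<And>x. x \<in> carrier X \<Longrightarrow> presented_lift G f (Pth_gen X x) = f x"
proof -
  let ?F = "free_group (carrier X)"
  interpret G: group G by fact
  interpret F: group ?F by (rule group_free_group)
  interpret h: group_hom ?F G "free_lift G f"
    by unfold_locales (rule G.free_lift_hom[OF f])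
  have rel: "free_lift G f u = free_lift G f v" if uv: "(u, v) \<in> Pth_rels X" for u v
  proof -
    obtain x a where xa: "x \<in> carrier X" "a \<in> carrier X" "u = fg_gen (x \<triangleleft> a)"
        "v = inv\<^bsub>?F\<^esub> fg_gen a \<otimes>\<^bsub>?F\<^esub> fg_gen x \<otimes>\<^bsub>?F\<^esub> fg_gen a"
      using uv by (auto simp: Pth_rels_def)
    moreover have "f y \<in> carrier G" if "y \<in> carrier X" for y using f that by auto
    ultimately show ?thesis
      by (simp add: fg_gen_in_free_group G.free_lift_gen rop_closed rop)
  qed
  show "presented_lift G f \<in> hom (Pth X) G"
    unfolding Pth_def using f Pth_rels_closed rel by (rule G.presented_lift_hom)
  show "presented_lift G f (Pth_gen X x) = f x" if "x \<in> carrier X" for x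
    unfolding Pth_gen_def using f Pth_rels_closed rel that by (rule G.presented_lift_gen)
qed

lemma Inn_apply_closed: "\<lbrakk>f \<in> carrier (Inn X); x \<in> carrier X\<rbrakk> \<Longrightarrow> f x \<in> carrier X"
  using Inn_subset_Aut Bij_imp_funcset[of f "carrier X"] by (auto simp: rack_Aut_def)

lemma Pth_to_Inn_group_hom: "group_hom (Pth X) (Inn X) (Pth_to_Inn X)"
  by (simp add: group_hom_def group_hom_axioms_def group_Pth group_Inn Pth_to_Inn_hom)

lemma Pth_to_Inn_closed:
  "\<lbrakk>p \<in> carrier (Pth X); x \<in> carrier X\<rbrakk> \<Longrightarrow> Pth_to_Inn X p x \<in> carrier X"
  using hom_in_carrier[OF Pth_to_Inn_hom] by (rule Inn_apply_closed)

lemma Pth_to_Inn_mult: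
  assumes "p \<in> carrier (Pth X)" "q \<in> carrier (Pth X)" "x \<in> carrier X"
  shows "Pth_to_Inn X (p \<otimes>\<^bsub>Pth X\<^esub> q) x = Pth_to_Inn X q (Pth_to_Inn X p x)"
  using assms hom_mult[OF Pth_to_Inn_hom] by (simp add: Inn_mult compose_eq)

lemma Pth_to_Inn_inv_gen:
  assumes "y \<in> carrier X" "x \<in> carrier X"
  shows "Pth_to_Inn X (inv\<^bsub>Pth X\<^esub> Pth_gen X y) x = x \<triangleleft>\<^sup>- y"
proof -
  interpret s: group_hom "Pth X" "Inn X" "Pth_to_Inn X" by (rule Pth_to_Inn_group_hom)
  show ?thesis
    using assms by (simp add: Pth_gen_closed Pth_to_Inn_gen Inn_inv_S)
qed

text \<open>For a generator \<open>p\<close> this is a defining relation of \<open>Pth X\<close>, and for the inverse of a generator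
  it is a defining relation solved for its middle factor. It passes to products because the action
  is a right action.\<close>

lemma Pth_gen_equivariant:
  assumes p: "p \<in> carrier (Pth X)" and x: "x \<in> carrier X"
  shows "Pth_gen X (Pth_to_Inn X p x) = inv\<^bsub>Pth X\<^esub> p \<otimes>\<^bsub>Pth X\<^esub> Pth_gen X x \<otimes>\<^bsub>Pth X\<^esub> p"
proof -
  interpret P: group "Pth X" by (rule group_Pth)
  interpret s: group_hom "Pth X" "Inn X" "Pth_to_Inn X" by (rule Pth_to_Inn_group_hom)
  show ?thesis
    using p[unfolded Pth_generate] x
  proof (induction arbitrary: x rule: generate.induct)
    case one
    then show ?case by (simp add: Inn_mult Pth_gen_closed)
  next
    case (incl p)
    then obtain y where y: "y \<in> carrier X" "p = Pth_gen X y" by blast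
    then show ?case
      using incl by (simp add: Pth_to_Inn_gen rack_S_def Pth_gen_rop)
  next
    case (inv p)
    then obtain y where y: "y \<in> carrier X" "p = Pth_gen X y" by blast
    have c: "Pth_gen X y \<in> carrier (Pth X)" "Pth_gen X (x \<triangleleft>\<^sup>- y) \<in> carrier (Pth X)"
      using y inv by (simp_all add: Pth_gen_closed rop_inv_closed)
    have "Pth_gen X x = inv\<^bsub>Pth X\<^esub> p \<otimes>\<^bsub>Pth X\<^esub> Pth_gen X (x \<triangleleft>\<^sup>- y) \<otimes>\<^bsub>Pth X\<^esub> p"
      using Pth_gen_rop[of "x \<triangleleft>\<^sup>- y" y] y inv by (simp add: rop_rop_inv rop_inv_closed)
    then have "Pth_gen X (x \<triangleleft>\<^sup>- y) = p \<otimes>\<^bsub>Pth X\<^esub> Pth_gen X x \<otimes>\<^bsub>Pth X\<^esub> inv\<^bsub>Pth X\<^esub> p"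
      using c y by (simp add: P.m_assoc P.cancel_inv_left)
    then show ?case using y inv c by (simp add: Pth_to_Inn_inv_gen del: s.hom_inv)
  next
    case (eng p q)
    then have c: "p \<in> carrier (Pth X)" "q \<in> carrier (Pth X)" by (simp_all flip: Pth_generate)
    then show ?case
      using eng by (simp add: Pth_to_Inn_mult Pth_to_Inn_closed Pth_gen_closed
          P.inv_mult_group P.m_assoc del: s.hom_mult)
  qed
qed

text \<open>Products of the form \<open>x y\<^sup>-\<^sup>1\<close> suffice to generate \<open>Pth0 X\<close>, since those of the form \<open>x\<^sup>-\<^sup>1 y\<close>
  are conjugate to them and the subgroup that they generate is normal. Normality depends on the
  rack relations: it fails for the analogous subgroup of a free group of rank at least \<open>2\<close>.\<close>

abbreviation diff_gens :: "'a letter list set set"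
  where "diff_gens \<equiv> {Pth_gen X a \<otimes>\<^bsub>Pth X\<^esub> inv\<^bsub>Pth X\<^esub> Pth_gen X b | a b.
    a \<in> carrier X \<and> b \<in> carrier X}"

text \<open>A conjugate of a generator of \<open>Pth X\<close> is again one, by equivariance. Hence already the set of
  the elements \<open>x y\<^sup>-\<^sup>1\<close> is stable under conjugation.\<close>

lemma diff_gens_normal: "generate (Pth X) diff_gens \<lhd> Pth X"
proof -
  interpret P: group "Pth X" by (rule group_Pth)
  show ?thesis
  proof (rule P.normal_generateI)
    show "diff_gens \<subseteq> carrier (Pth X)" by (auto simp: Pth_gen_closed)
  next
    fix h g assume "h \<in> diff_gens" and g: "g \<in> carrier (Pth X)"
    then obtain a b where ab: "a \<in> carrier X" "b \<in> carrier X"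
      and h: "h = Pth_gen X a \<otimes>\<^bsub>Pth X\<^esub> inv\<^bsub>Pth X\<^esub> Pth_gen X b" by blast
    let ?t = "Pth_to_Inn X (inv\<^bsub>Pth X\<^esub> g)"
    have gen: "Pth_gen X (?t x) = g \<otimes>\<^bsub>Pth X\<^esub> Pth_gen X x \<otimes>\<^bsub>Pth X\<^esub> inv\<^bsub>Pth X\<^esub> g"
      if "x \<in> carrier X" for x
      using Pth_gen_equivariant[of "inv\<^bsub>Pth X\<^esub> g" x] g that by simp
    have "g \<otimes>\<^bsub>Pth X\<^esub> h \<otimes>\<^bsub>Pth X\<^esub> inv\<^bsub>Pth X\<^esub> g
        = Pth_gen X (?t a) \<otimes>\<^bsub>Pth X\<^esub> inv\<^bsub>Pth X\<^esub> Pth_gen X (?t b)"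
      using ab g unfolding gen[OF ab(1)] gen[OF ab(2)] h
      by (simp add: Pth_gen_closed P.inv_mult_group P.m_assoc P.cancel_inv_left)
    then show "g \<otimes>\<^bsub>Pth X\<^esub> h \<otimes>\<^bsub>Pth X\<^esub> inv\<^bsub>Pth X\<^esub> g \<in> diff_gens"
      using ab g Pth_to_Inn_closed[of "inv\<^bsub>Pth X\<^esub> g"] by auto
  qed
qed

lemma Pth_degree_group_hom:
  "group_hom (Pth X) integer_group (presented_lift integer_group (\<lambda>_. 1))"
  using Pth_degree_hom by (simp add: group_hom_def group_hom_axioms_def group_Pth)

lemma group_Pth0: "group (Pth0 X)"
proof -
  interpret d: group_hom "Pth X" integer_group "presented_lift integer_group (\<lambda>_. 1)"
    by (rule Pth_degree_group_hom)
  show ?thesis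
    unfolding Pth0_def by (rule subgroup.subgroup_is_group[OF d.subgroup_kernel group_Pth])
qed

text \<open>Modulo the normal subgroup generated by the elements \<open>x y\<^sup>-\<^sup>1\<close>, all generators agree with a
  single one, \<open>t\<close>. Every \<open>q\<close> is thus congruent to the power of \<open>t\<close> whose exponent is the degree of
  \<open>q\<close>, and this power is trivial in degree \<open>0\<close>. The empty rack has no \<open>t\<close>, but there
  \<open>Pth X\<close> is trivial.\<close>

lemma Pth0_generate: "carrier (Pth0 X) = generate (Pth X) diff_gens"
proof -
  let ?K = "generate (Pth X) diff_gens" and ?d = "presented_lift integer_group (\<lambda>_. 1)"
  interpret P: group "Pth X" by (rule group_Pth)
  interpret d: group_hom "Pth X" integer_group ?d by (rule Pth_degree_group_hom)
  interpret K: normal ?K "Pth X" by (rule diff_gens_normal)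
  have "?K \<subseteq> kernel (Pth X) integer_group ?d"
    by (rule P.generate_subgroup_incl[OF _ d.subgroup_kernel])
       (auto simp: kernel_def Pth_gen_closed Pth_degree_gen)
  moreover have "p \<in> ?K" if p: "p \<in> carrier (Pth X)" "?d p = 0" for p
  proof (cases "carrier X = {}")
    case True
    then show ?thesis using p(1) by (subst (asm) Pth_generate) simp
  next
    case False
    then obtain x where x: "x \<in> carrier X" by blast
    define t where "t = Pth_gen X x"
    have t: "t \<in> carrier (Pth X)" using x by (simp add: t_def Pth_gen_closed)
    have "q \<otimes>\<^bsub>Pth X\<^esub> t [^]\<^bsub>Pth X\<^esub> (- ?d q) \<in> ?K" if "q \<in> carrier (Pth X)" for q
      using that[unfolded Pth_generate]
    proof (induction rule: generate.induct)
      case one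
      then show ?case by simp
    next
      case (incl q)
      then obtain y where y: "y \<in> carrier X" "q = Pth_gen X y" by blast
      then have "q \<otimes>\<^bsub>Pth X\<^esub> inv\<^bsub>Pth X\<^esub> t \<in> diff_gens" using x by (auto simp: t_def)
      then show ?case
        using t y by (simp add: Pth_degree_gen P.int_pow_neg generate.incl)
    next
      case (inv q)
      then obtain y where y: "y \<in> carrier X" "q = Pth_gen X y" by blast
      then have q: "q \<in> carrier (Pth X)" by (simp add: Pth_gen_closed)
      have "t \<otimes>\<^bsub>Pth X\<^esub> inv\<^bsub>Pth X\<^esub> q \<in> ?K"
        using x y by (auto simp: t_def intro!: generate.incl)
      \<comment> \<open>Conjugation by \<open>q\<close> turns \<open>t q\<^sup>-\<^sup>1\<close> into \<open>q\<^sup>-\<^sup>1 t\<close>.\<close>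
      then have "inv\<^bsub>Pth X\<^esub> q \<otimes>\<^bsub>Pth X\<^esub> (t \<otimes>\<^bsub>Pth X\<^esub> inv\<^bsub>Pth X\<^esub> q) \<otimes>\<^bsub>Pth X\<^esub> q \<in> ?K"
        using q K.inv_op_closed1 by blast
      then show ?case
        using q t y by (simp add: Pth_degree_gen P.m_assoc)
    next
      case (eng q r)
      then have c: "q \<in> carrier (Pth X)" "r \<in> carrier (Pth X)" by (simp_all flip: Pth_generate)
      let ?m = "t [^]\<^bsub>Pth X\<^esub> (- ?d q)" and ?n = "t [^]\<^bsub>Pth X\<^esub> (- ?d r)"
      \<comment> \<open>In \<open>q r ?n ?m\<close> the element \<open>r ?n\<close> of the subgroup separates \<open>q\<close> from \<open>?m\<close>; conjugation by
        \<open>q\<close> moves it to the left.\<close>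
      have "q \<otimes>\<^bsub>Pth X\<^esub> (r \<otimes>\<^bsub>Pth X\<^esub> ?n) \<otimes>\<^bsub>Pth X\<^esub> inv\<^bsub>Pth X\<^esub> q \<in> ?K"
        using c eng.IH(2) K.inv_op_closed2 by blast
      then have "(q \<otimes>\<^bsub>Pth X\<^esub> (r \<otimes>\<^bsub>Pth X\<^esub> ?n) \<otimes>\<^bsub>Pth X\<^esub> inv\<^bsub>Pth X\<^esub> q)
          \<otimes>\<^bsub>Pth X\<^esub> (q \<otimes>\<^bsub>Pth X\<^esub> ?m) \<in> ?K"
        using eng.IH(1) K.m_closed by blast
      also have "(q \<otimes>\<^bsub>Pth X\<^esub> (r \<otimes>\<^bsub>Pth X\<^esub> ?n) \<otimes>\<^bsub>Pth X\<^esub> inv\<^bsub>Pth X\<^esub> q)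
          \<otimes>\<^bsub>Pth X\<^esub> (q \<otimes>\<^bsub>Pth X\<^esub> ?m) = q \<otimes>\<^bsub>Pth X\<^esub> r \<otimes>\<^bsub>Pth X\<^esub> (?n \<otimes>\<^bsub>Pth X\<^esub> ?m)"
        using c t by (simp add: P.m_assoc P.cancel_inv_left)
      also have "?n \<otimes>\<^bsub>Pth X\<^esub> ?m = t [^]\<^bsub>Pth X\<^esub> (- ?d (q \<otimes>\<^bsub>Pth X\<^esub> r))"
        using c by (simp add: P.int_pow_mult[OF t, symmetric] minus_diff_commute)
      finally show ?case .
    qed
    from this[OF p(1)] show ?thesis using p by simp
  qed
  ultimately show ?thesis by (auto simp: Pth0_def kernel_def)
qed

lemma Pth_to_Inn_Pth0_image: "Pth_to_Inn X ` carrier (Pth0 X) = carrier (Inn0 X)"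
proof -
  interpret s: group_hom "Pth X" "Inn X" "Pth_to_Inn X" by (rule Pth_to_Inn_group_hom)
  let ?S = "{rack_S X a \<otimes>\<^bsub>Inn X\<^esub> inv\<^bsub>Inn X\<^esub> rack_S X b | a b. a \<in> carrier X \<and> b \<in> carrier X}"
  have "Pth_to_Inn X ` carrier (Pth0 X) = generate (Inn X) (Pth_to_Inn X ` diff_gens)"
    unfolding Pth0_generate by (rule s.generate_img[symmetric]) (auto simp: Pth_gen_closed)
  also have "Pth_to_Inn X ` diff_gens = (\<lambda>(a, b). Pth_to_Inn X
      (Pth_gen X a \<otimes>\<^bsub>Pth X\<^esub> inv\<^bsub>Pth X\<^esub> Pth_gen X b)) ` (carrier X \<times> carrier X)"
    by auto
  also have "\<dots> = (\<lambda>(a, b). rack_S X a \<otimes>\<^bsub>Inn X\<^esub> inv\<^bsub>Inn X\<^esub> rack_S X b) ` (carrier X \<times> carrier X)"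
    by (rule image_cong) (auto simp: Pth_gen_closed Pth_to_Inn_gen)
  also have "\<dots> = carrier (Inn X) \<inter> ?S"
    by (auto simp: rack_S_in_Inn)
  finally show ?thesis
    by (simp only: Inn0_def carrier_subgroup_generated)
qed

end

section \<open>The path group of a free quandle\<close>

lemma free_quandle_carrier:
  "(a, g) \<in> carrier (free_quandle A) \<longleftrightarrow> a \<in> A \<and> g \<in> carrier (free_group A)
    \<and> free_lift integer_group (\<lambda>_. 1) g = 0"
  by (auto simp: free_quandle_def free_group0_def kernel_def)

lemma free_degree_group_hom:
  "group_hom (free_group A) integer_group (free_lift integer_group (\<lambda>_. 1))"
  by (auto simp: group_hom_def group_hom_axioms_def group_free_group
      intro!: group.free_lift_hom)

lemma free_degree_gen: "free_lift integer_group (\<lambda>_. 1) (fg_gen a) = 1"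
  using group.free_lift_gen[of integer_group "\<lambda>_. 1" a] by simp

lemma group_free_group0: "group (free_group0 A)"
  unfolding free_group0_def
  by (rule subgroup.subgroup_is_group[OF group_hom.subgroup_kernel[OF free_degree_group_hom]
        group_free_group])

lemma free_to_Pth_group_hom: "group_hom (free_group A) (Pth (free_quandle A)) (free_to_Pth A)"
proof -
  interpret Q: quandle "free_quandle A" by (rule quandle_free_quandle)
  show ?thesis
    by (simp add: group_hom_def group_hom_axioms_def group_free_group Q.group_Pth free_to_Pth_hom)
qed

text \<open>The inverse of \<open>free_to_Pth\<close>. The lift is meaningful because \<open>(a, g) \<mapsto> g\<^sup>-\<^sup>1 a g\<close> turns the
  operation of the free quandle into conjugation.\<close>

definition Pth_to_free :: "'a set \<Rightarrow> ('a \<times> 'a letter list) letter list set \<Rightarrow> 'a letter list"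
  where "Pth_to_free A = presented_lift (free_group A)
    (\<lambda>(a, g). inv\<^bsub>free_group A\<^esub> g \<otimes>\<^bsub>free_group A\<^esub> fg_gen a \<otimes>\<^bsub>free_group A\<^esub> g)"

lemma Pth_to_free:
  shows Pth_to_free_group_hom: "group_hom (Pth (free_quandle A)) (free_group A) (Pth_to_free A)"
    and Pth_to_free_gen: "(a, g) \<in> carrier (free_quandle A) \<Longrightarrow>
      Pth_to_free A (Pth_gen (free_quandle A) (a, g))
        = inv\<^bsub>free_group A\<^esub> g \<otimes>\<^bsub>free_group A\<^esub> fg_gen a \<otimes>\<^bsub>free_group A\<^esub> g"
proof -
  let ?F = "free_group A" and ?Q = "free_quandle A"
  let ?f = "\<lambda>(a, g). inv\<^bsub>?F\<^esub> g \<otimes>\<^bsub>?F\<^esub> fg_gen a \<otimes>\<^bsub>?F\<^esub> g"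
  interpret F: group ?F by (rule group_free_group)
  interpret Q: quandle ?Q by (rule quandle_free_quandle)
  have f: "?f \<in> carrier ?Q \<rightarrow> carrier ?F"
    by (auto simp: free_quandle_carrier fg_gen_in_free_group)
  have rop: "?f (x \<triangleleft>\<^bsub>?Q\<^esub> y) = inv\<^bsub>?F\<^esub> ?f y \<otimes>\<^bsub>?F\<^esub> ?f x \<otimes>\<^bsub>?F\<^esub> ?f y"
    if xy: "x \<in> carrier ?Q" "y \<in> carrier ?Q" for x y
  proof -
    obtain a g b h where eq: "x = (a, g)" "y = (b, h)" by fastforce
    have c: "fg_gen a \<in> carrier ?F" "fg_gen b \<in> carrier ?F" "g \<in> carrier ?F" "h \<in> carrier ?F"
      using xy by (auto simp: eq free_quandle_carrier fg_gen_in_free_group)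
    show ?thesis
      using c by (simp add: eq free_quandle_def F.inv_mult_group F.m_assoc F.cancel_inv_left)
  qed
  show "group_hom (Pth ?Q) ?F (Pth_to_free A)"
    using Q.Pth_lift_hom[OF F.is_group f rop]
    by (simp add: group_hom_def group_hom_axioms_def F.is_group Q.group_Pth Pth_to_free_def)
  show "Pth_to_free A (Pth_gen ?Q (a, g)) = inv\<^bsub>?F\<^esub> g \<otimes>\<^bsub>?F\<^esub> fg_gen a \<otimes>\<^bsub>?F\<^esub> g"
    if "(a, g) \<in> carrier ?Q"
    using Q.Pth_lift_gen[OF F.is_group f rop that] by (simp add: Pth_to_free_def)
qed

text \<open>Each generator \<open>b\<close> contributes, besides its factor on the right, a factor \<open>a\<^sup>-\<^sup>1\<close> on the left,
  which keeps the second component in degree \<open>0\<close>. Elements of nonzero degree have to be included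
  since the induction builds \<open>h\<close> from generators.\<close>

lemma free_to_Pth_act:
  assumes h: "h \<in> carrier (free_group A)" and x: "(a, g) \<in> carrier (free_quandle A)"
  shows "Pth_to_Inn (free_quandle A) (free_to_Pth A h) (a, g)
    = (a, fg_gen a [^]\<^bsub>free_group A\<^esub> (- free_lift integer_group (\<lambda>_. 1) h)
        \<otimes>\<^bsub>free_group A\<^esub> g \<otimes>\<^bsub>free_group A\<^esub> h)"
proof -
  let ?F = "free_group A" and ?Q = "free_quandle A" and ?d = "free_lift integer_group (\<lambda>_. 1)"
  interpret F: group ?F by (rule group_free_group)
  interpret Q: quandle ?Q by (rule quandle_free_quandle)
  interpret d: group_hom ?F integer_group ?d by (rule free_degree_group_hom)
  interpret p: group_hom ?F "Pth ?Q" "free_to_Pth A" by (rule free_to_Pth_group_hom)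
  interpret s: group_hom "Pth ?Q" "Inn ?Q" "Pth_to_Inn ?Q" by (rule Q.Pth_to_Inn_group_hom)
  show ?thesis
    using h[unfolded free_group_generate] x
  proof (induction arbitrary: g rule: generate.induct)
    case one
    then show ?case by (simp add: Q.Inn_mult free_quandle_carrier)
  next
    case (incl h)
    then obtain b where b: "b \<in> A" "h = fg_gen b" by blast
    then show ?case
      using incl free_quandle_unit_in[OF b(1)]
      by (simp add: free_to_Pth_gen Q.Pth_to_Inn_gen rack_S_def free_degree_gen F.int_pow_neg
          free_quandle_carrier fg_gen_in_free_group)
         (simp add: free_quandle_def free_quandle_unit_def fg_gen_in_free_group)
  next
    case (inv h)
    then obtain b where b: "b \<in> A" "h = fg_gen b" by blast
    then show ?case
      using inv free_quandle_unit_in[OF b(1)]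
      by (simp add: free_to_Pth_gen Q.Pth_to_Inn_inv_gen free_degree_gen fg_gen_in_free_group
           free_quandle_carrier del: s.hom_inv)
         (simp add: free_quandle_def free_quandle_unit_def fg_gen_in_free_group)
  next
    case (eng h k)
    then have c: "h \<in> carrier ?F" "k \<in> carrier ?F" by (simp_all flip: free_group_generate)
    have a: "a \<in> A" "fg_gen a \<in> carrier ?F" "g \<in> carrier ?F"
      using eng.prems by (simp_all add: free_quandle_carrier fg_gen_in_free_group)
    let ?m = "fg_gen a [^]\<^bsub>?F\<^esub> (- ?d h)" and ?n = "fg_gen a [^]\<^bsub>?F\<^esub> (- ?d k)"
    have "(a, ?m \<otimes>\<^bsub>?F\<^esub> g \<otimes>\<^bsub>?F\<^esub> h) \<in> carrier ?Q"
      using Q.Pth_to_Inn_closed[OF p.hom_closed[OF c(1)] eng.prems]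
      by (simp add: eng.IH(1)[OF eng.prems])
    then have "Pth_to_Inn ?Q (free_to_Pth A (h \<otimes>\<^bsub>?F\<^esub> k)) (a, g)
        = (a, ?n \<otimes>\<^bsub>?F\<^esub> (?m \<otimes>\<^bsub>?F\<^esub> g \<otimes>\<^bsub>?F\<^esub> h) \<otimes>\<^bsub>?F\<^esub> k)"
      using c eng by (simp add: Q.Pth_to_Inn_mult del: s.hom_mult)
    also have "?n \<otimes>\<^bsub>?F\<^esub> (?m \<otimes>\<^bsub>?F\<^esub> g \<otimes>\<^bsub>?F\<^esub> h) \<otimes>\<^bsub>?F\<^esub> k
        = (?n \<otimes>\<^bsub>?F\<^esub> ?m) \<otimes>\<^bsub>?F\<^esub> g \<otimes>\<^bsub>?F\<^esub> (h \<otimes>\<^bsub>?F\<^esub> k)"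
      using a c by (simp add: F.m_assoc)
    also have "?n \<otimes>\<^bsub>?F\<^esub> ?m = fg_gen a [^]\<^bsub>?F\<^esub> (- ?d (h \<otimes>\<^bsub>?F\<^esub> k))"
      using c by (simp add: F.int_pow_mult[OF a(2), symmetric] minus_diff_commute)
    finally show ?case .
  qed
qed

lemma free_to_Pth_act0:
  assumes h: "h \<in> carrier (free_group0 A)" and x: "x \<in> carrier (free_quandle A)"
  shows "Pth_to_Inn (free_quandle A) (free_to_Pth A h) x = free_quandle_act A x h"
proof -
  interpret F: group "free_group A" by (rule group_free_group)
  obtain a g where xe: "x = (a, g)" by fastforce
  have h': "h \<in> carrier (free_group A)" "free_lift integer_group (\<lambda>_. 1) h = 0"
    using h by (auto simp: free_group0_def kernel_def)
  show ?thesis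
    using free_to_Pth_act[OF h'(1) x[unfolded xe]] h' x
    by (simp add: xe free_quandle_act_def free_quandle_carrier)
qed

lemma Pth_to_free_free_to_Pth:
  assumes "h \<in> carrier (free_group A)"
  shows "Pth_to_free A (free_to_Pth A h) = h"
proof -
  let ?F = "free_group A" and ?Q = "free_quandle A"
  interpret F: group ?F by (rule group_free_group)
  interpret p: group_hom ?F "Pth ?Q" "free_to_Pth A" by (rule free_to_Pth_group_hom)
  interpret r: group_hom "Pth ?Q" ?F "Pth_to_free A" by (rule Pth_to_free_group_hom)
  have "group_hom ?F ?F (\<lambda>h. Pth_to_free A (free_to_Pth A h))"
    by unfold_locales (auto intro!: homI)
  moreover have "group_hom ?F ?F (\<lambda>h. h)"
    by unfold_locales (auto intro!: homI)
  ultimately show ?thesis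
  proof (rule hom_eq_on_generate)
    fix u assume "u \<in> fg_gen ` A"
    then obtain a where a: "a \<in> A" "u = fg_gen a" by blast
    then show "Pth_to_free A (free_to_Pth A u) = u"
      using free_quandle_unit_in[OF a(1)] Pth_to_free_gen[of a "\<one>\<^bsub>?F\<^esub>" A]
      by (simp add: free_to_Pth_gen free_quandle_unit_def fg_gen_in_free_group)
  qed (use assms in \<open>auto simp: fg_gen_in_free_group simp flip: free_group_generate\<close>)
qed

text \<open>The generator at \<open>(a, g)\<close> goes to \<open>g\<^sup>-\<^sup>1 a g\<close> and back to the conjugate of the generator at
  \<open>(a, e)\<close> by the image of \<open>g\<close>. By equivariance this is the generator at the point to which \<open>g\<close>
  moves \<open>(a, e)\<close>, and as \<open>g\<close> has degree \<open>0\<close> that point is \<open>(a, g)\<close>.\<close>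

lemma free_to_Pth_Pth_to_free:
  assumes "p \<in> carrier (Pth (free_quandle A))"
  shows "free_to_Pth A (Pth_to_free A p) = p"
proof -
  let ?F = "free_group A" and ?Q = "free_quandle A"
  interpret F: group ?F by (rule group_free_group)
  interpret Q: quandle ?Q by (rule quandle_free_quandle)
  interpret p: group_hom ?F "Pth ?Q" "free_to_Pth A" by (rule free_to_Pth_group_hom)
  interpret r: group_hom "Pth ?Q" ?F "Pth_to_free A" by (rule Pth_to_free_group_hom)
  have "group_hom (Pth ?Q) (Pth ?Q) (\<lambda>p. free_to_Pth A (Pth_to_free A p))"
    by unfold_locales (auto intro!: homI)
  moreover have "group_hom (Pth ?Q) (Pth ?Q) (\<lambda>p. p)"
    by unfold_locales (auto intro!: homI)
  ultimately show ?thesis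
  proof (rule hom_eq_on_generate)
    fix q assume "q \<in> Pth_gen ?Q ` carrier ?Q"
    then obtain a g where x: "(a, g) \<in> carrier ?Q" and q: "q = Pth_gen ?Q (a, g)" by auto
    then have a: "a \<in> A" and g: "g \<in> carrier ?F" "g \<in> carrier (free_group0 A)"
      by (auto simp: free_quandle_carrier free_group0_def kernel_def)
    let ?u = "free_quandle_unit A a"
    have "free_to_Pth A (Pth_to_free A q)
        = inv\<^bsub>Pth ?Q\<^esub> free_to_Pth A g \<otimes>\<^bsub>Pth ?Q\<^esub> Pth_gen ?Q ?u \<otimes>\<^bsub>Pth ?Q\<^esub> free_to_Pth A g"
      using x a g by (simp add: q Pth_to_free_gen fg_gen_in_free_group free_to_Pth_gen)
    also have "\<dots> = Pth_gen ?Q (Pth_to_Inn ?Q (free_to_Pth A g) ?u)"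
      using g a by (simp add: Q.Pth_gen_equivariant free_quandle_unit_in)
    also have "Pth_to_Inn ?Q (free_to_Pth A g) ?u = (a, g)"
      using g a by (simp add: free_to_Pth_act0 free_quandle_unit_in)
         (simp add: free_quandle_act_def free_quandle_unit_def)
    finally show "free_to_Pth A (Pth_to_free A q) = q" by (simp add: q)
  qed (use assms in \<open>auto simp: Q.Pth_gen_closed simp flip: Q.Pth_generate\<close>)
qed

lemma Pth_degree_free_to_Pth:
  assumes "h \<in> carrier (free_group A)"
  shows "presented_lift integer_group (\<lambda>_. 1) (free_to_Pth A h) = free_lift integer_group (\<lambda>_. 1) h"
proof -
  let ?F = "free_group A" and ?Q = "free_quandle A"
  let ?e = "presented_lift integer_group (\<lambda>_. 1) :: ('a \<times> 'a letter list) letter list set \<Rightarrow> int"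
  interpret Q: quandle ?Q by (rule quandle_free_quandle)
  interpret p: group_hom ?F "Pth ?Q" "free_to_Pth A" by (rule free_to_Pth_group_hom)
  interpret e: group_hom "Pth ?Q" integer_group ?e by (rule Q.Pth_degree_group_hom)
  have "group_hom ?F integer_group (\<lambda>h. ?e (free_to_Pth A h))"
    by unfold_locales (auto intro!: homI)
  then show ?thesis
    by (rule hom_eq_on_generate[where S = "fg_gen ` A", OF _ free_degree_group_hom])
       (use assms in \<open>auto simp: fg_gen_in_free_group free_to_Pth_gen Q.Pth_degree_gen
          free_quandle_unit_in free_degree_gen simp flip: free_group_generate\<close>)
qed

text \<open>The mutually inverse isomorphisms of the full groups preserve the degree.\<close>

lemma free_to_Pth_iso0: "free_to_Pth A \<in> iso (free_group0 A) (Pth0 (free_quandle A))"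
proof -
  let ?F = "free_group A" and ?Q = "free_quandle A"
  interpret p: group_hom ?F "Pth ?Q" "free_to_Pth A" by (rule free_to_Pth_group_hom)
  interpret r: group_hom "Pth ?Q" ?F "Pth_to_free A" by (rule Pth_to_free_group_hom)
  have "free_to_Pth A \<in> hom (free_group0 A) (Pth0 ?Q)"
    by (auto intro!: homI simp: free_group0_def Pth0_def kernel_def Pth_degree_free_to_Pth)
  moreover have "bij_betw (free_to_Pth A) (carrier (free_group0 A)) (carrier (Pth0 ?Q))"
  proof (rule bij_betwI[where g = "Pth_to_free A"])
    have "free_lift integer_group (\<lambda>_. 1) (Pth_to_free A p)
        = presented_lift integer_group (\<lambda>_. 1) p" if "p \<in> carrier (Pth ?Q)" for p
      using Pth_degree_free_to_Pth[OF r.hom_closed[OF that]] free_to_Pth_Pth_to_free[OF that]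
      by simp
    then show "Pth_to_free A \<in> carrier (Pth0 ?Q) \<rightarrow> carrier (free_group0 A)"
      by (auto simp: free_group0_def Pth0_def kernel_def)
  qed (auto simp: free_group0_def Pth0_def kernel_def Pth_degree_free_to_Pth
         Pth_to_free_free_to_Pth free_to_Pth_Pth_to_free)
  ultimately show ?thesis by (simp add: iso_def)
qed

section \<open>Free actions\<close>

lemma acts_freely_iso:
  assumes free: "acts_freely G E act" and iso: "f \<in> iso G H" and "group G" "group H"
    and eq: "\<And>x g. \<lbrakk>x \<in> E; g \<in> carrier G\<rbrakk> \<Longrightarrow> act' x (f g) = act x g"
  shows "acts_freely H E act'"
proof -
  interpret f: group_hom G H f
    using iso assms(3,4) by (simp add: group_hom_def group_hom_axioms_def iso_def)
  have surj: "carrier H = f ` carrier G" using iso by (auto simp: iso_def bij_betw_def)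
  have "act' x \<one>\<^bsub>H\<^esub> = act x \<one>\<^bsub>G\<^esub>" if "x \<in> E" for x
    using eq[OF that, of "\<one>\<^bsub>G\<^esub>"] by simp
  moreover have "act' x (f g \<otimes>\<^bsub>H\<^esub> f h) = act x (g \<otimes>\<^bsub>G\<^esub> h)"
    if "x \<in> E" "g \<in> carrier G" "h \<in> carrier G" for x g h
    using eq[OF that(1), of "g \<otimes>\<^bsub>G\<^esub> h"] that by simp
  moreover have "f g = \<one>\<^bsub>H\<^esub>" if "x \<in> E" "g \<in> carrier G" "act' x (f g) = x" for x g
  proof -
    have "g = \<one>\<^bsub>G\<^esub>" using free that by (simp add: acts_freely_def eq)
    then show ?thesis by simp
  qed
  ultimately show ?thesis
    using free unfolding acts_freely_def surj by (simp add: eq)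
qed

lemma free_group0_acts_freely:
  "acts_freely (free_group0 A) (carrier (free_quandle A)) (free_quandle_act A)"
proof -
  interpret F: group "free_group A" by (rule group_free_group)
  interpret d: group_hom "free_group A" integer_group "free_lift integer_group (\<lambda>_. 1)"
    by (rule free_degree_group_hom)
  show ?thesis
    by (auto simp: acts_freely_def free_quandle_act_def free_quandle_carrier free_group0_def
        kernel_def F.m_assoc)
qed

lemma free_group_empty: "carrier (free_group {}) = {[]}"
  by (auto simp: free_group_def)

text \<open>An element \<open>h\<close> of \<open>free_group0 A\<close> is read off from its action as the second component of the
  image of \<open>(a, e)\<close>. This needs some \<open>a\<close> in \<open>A\<close>; if \<open>A\<close> is empty, the free group is trivial.\<close>

lemma Pth_to_Inn_iso0:
  "Pth_to_Inn (free_quandle A) \<in> iso (Pth0 (free_quandle A)) (Inn0 (free_quandle A))"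
proof -
  let ?Q = "free_quandle A"
  interpret Q: quandle ?Q by (rule quandle_free_quandle)
  interpret s: group_hom "Pth ?Q" "Inn ?Q" "Pth_to_Inn ?Q" by (rule Q.Pth_to_Inn_group_hom)
  have surj: "Pth_to_Inn ?Q ` carrier (Pth0 ?Q) = carrier (Inn0 ?Q)"
    by (rule Q.Pth_to_Inn_Pth0_image)
  then have "Pth_to_Inn ?Q \<in> hom (Pth0 ?Q) (Inn0 ?Q)"
    by (auto intro!: homI simp: Pth0_def Inn0_def kernel_def)
  moreover have "inj_on (Pth_to_Inn ?Q) (carrier (Pth0 ?Q))"
  proof -
    have im: "carrier (Pth0 ?Q) = free_to_Pth A ` carrier (free_group0 A)"
      using free_to_Pth_iso0 by (auto simp: iso_def bij_betw_def)
    have "h = k" if hk: "h \<in> carrier (free_group0 A)" "k \<in> carrier (free_group0 A)"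
      "Pth_to_Inn ?Q (free_to_Pth A h) = Pth_to_Inn ?Q (free_to_Pth A k)" for h k
    proof -
      have hk': "h \<in> carrier (free_group A)" "k \<in> carrier (free_group A)"
        using hk by (auto simp: free_group0_def kernel_def)
      show ?thesis
      proof (cases "A = {}")
        case True
        then show ?thesis using hk' by (simp add: free_group_empty)
      next
        case False
        interpret F: group "free_group A" by (rule group_free_group)
        obtain a where a: "a \<in> A" using False by blast
        have "free_quandle_act A (free_quandle_unit A a) h = free_quandle_act A (free_quandle_unit A a) k"
          using hk free_quandle_unit_in[OF a] by (simp flip: free_to_Pth_act0)
        then show ?thesis
          using hk' by (simp add: free_quandle_act_def free_quandle_unit_def)
      qed
    qed
    then show ?thesis by (auto simp: im inj_on_def)
  qed
  ultimately show ?thesis using surj by (simp add: iso_def bij_betw_def)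
qed

theorem proposition2p5p5p1:
  fixes A :: "'a set"
  shows "free_to_Pth A \<in> iso (free_group0 A) (Pth0 (free_quandle A))
    \<and> Pth_to_Inn (free_quandle A) \<in> iso (Pth0 (free_quandle A)) (Inn0 (free_quandle A))
    \<and> (\<forall>x\<in>carrier (free_quandle A). \<forall>h\<in>carrier (free_group0 A).
        Pth_act (free_quandle A) x (free_to_Pth A h) = free_quandle_act A x h)
    \<and> (\<forall>x\<in>carrier (free_quandle A). \<forall>p\<in>carrier (Pth0 (free_quandle A)).
        Pth_to_Inn (free_quandle A) p x = Pth_act (free_quandle A) x p)
    \<and> acts_freely (free_group0 A) (carrier (free_quandle A)) (free_quandle_act A)
    \<and> acts_freely (Pth0 (free_quandle A)) (carrier (free_quandle A)) (Pth_act (free_quandle A))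
    \<and> acts_freely (Inn0 (free_quandle A)) (carrier (free_quandle A)) (\<lambda>x f. f x)"
proof -
  let ?Q = "free_quandle A"
  interpret Q: quandle ?Q by (rule quandle_free_quandle)
  have Inn0: "group (Inn0 ?Q)"
    unfolding Inn0_def by (rule group.group_subgroup_generated[OF Q.group_Inn])
  have s: "Pth_to_Inn ?Q p x = Pth_act ?Q x p" if "x \<in> carrier ?Q" "p \<in> carrier (Pth0 ?Q)" for x p
    using that Q.Pth_act_eq by (simp add: Pth0_def kernel_def)
  have phi: "Pth_act ?Q x (free_to_Pth A h) = free_quandle_act A x h"
    if "x \<in> carrier ?Q" "h \<in> carrier (free_group0 A)" for x h
    using that free_to_Pth_act0 s hom_in_carrier[OF iso_imp_homomorphism[OF free_to_Pth_iso0]]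
    by metis
  have Pth0: "acts_freely (Pth0 ?Q) (carrier ?Q) (Pth_act ?Q)"
    by (rule acts_freely_iso[OF free_group0_acts_freely free_to_Pth_iso0 group_free_group0
          Q.group_Pth0 phi])
  have "acts_freely (Inn0 ?Q) (carrier ?Q) (\<lambda>x f. f x)"
    by (rule acts_freely_iso[where act' = "\<lambda>x f. f x", OF Pth0 Pth_to_Inn_iso0 Q.group_Pth0 Inn0 s])
  with Pth0 s phi free_to_Pth_iso0 Pth_to_Inn_iso0 free_group0_acts_freely show ?thesis by blast
qed

end
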